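(* For every odd prime power $q\ge 7$, there exists a linear $K_{4,4}$-free pair of orthogonal latin squares of order $q$. For every prime power $q\ge 4$, there exists a linear pair of orthogonal latin squares of order $q$ containing a $K_{4,4}$-pattern.
   Context: A latin square of order $n$ is a set of $n^2$ ordered triples from $R\times C\times L$, $|R|=|C|=|L|=n$, no two of which differ in exactly one position; it is identified with the function (table) $S$ with $S(r,c)=l$ if $(r,c,l)$ is in the set. Two latin squares $A$, $B$ with the same row set $R$ and column set $C$ are orthogonal if $A(r,c)=A(r',c')$ and $B(r,c)=B(r',c')$ imply $(r,c)=(r',c')$. A pair $(A,B)$ of orthogonal latin squares is treated as the set of ordered quadruples $\{(r,c,A(r,c),B(r,c)) : r\in R,\ c\in C\}$; the graph $\Gamma(A,B)$ has this set as its vertex set, two distinct quadruples being adjacent if they coincide in one position. A $K_{4,4}$-pattern in $(A,B)$ is a set of $8$ elements of $(A,B)$ that induces a subgraph of $\Gamma(A,B)$ isomorphic to the complete bipartite graph $K_{4,4}$. The pair $(A,B)$ is $K_{4,4}$-free if it has no $K_{4,4}$-patterns. For a prime power $q$, a pair of orthogonal latin squares of order $q$ is linear if $R=C=L=\mathrm{GF}(q)$ and both latin squares are linear functions $\mathrm{GF}(q)^2\to\mathrm{GF}(q)$ of $(r,c)$. *)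

theory Defs
  imports
    "HOL-Algebra.Ring"
    "HOL-Algebra.Coset"
    "HOL-Number_Theory.Prime_Powers"
    "Graph_Theory.Graph_Theory"
begin

definition latin_square ::
  "nat \<Rightarrow> 'r set \<Rightarrow> 'c set \<Rightarrow> 'l set \<Rightarrow> ('r \<times> 'c \<times> 'l) set \<Rightarrow> bool" where
  "latin_square n R C L T \<longleftrightarrow>
     finite R \<and> finite C \<and> finite L \<and> card R = n \<and> card C = n \<and> card L = n \<and>
     T \<subseteq> R \<times> C \<times> L \<and> card T = n^2 \<and>
     (\<forall>(r, c, l) \<in> T. \<forall>(r', c', l') \<in> T.
        of_bool (r \<noteq> r') + of_bool (c \<noteq> c') + of_bool (l \<noteq> l') \<noteq> (1::nat))"

text \<open>A latin square is given below by its table; values of the table outside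
  \<open>R \<times> C\<close> are irrelevant.\<close>

definition table_triples :: "'r set \<Rightarrow> 'c set \<Rightarrow> ('r \<Rightarrow> 'c \<Rightarrow> 'l) \<Rightarrow> ('r \<times> 'c \<times> 'l) set" where
  "table_triples R C S = {(r, c, S r c) | r c. r \<in> R \<and> c \<in> C}"

definition orthogonal ::
  "'r set \<Rightarrow> 'c set \<Rightarrow> ('r \<Rightarrow> 'c \<Rightarrow> 'l) \<Rightarrow> ('r \<Rightarrow> 'c \<Rightarrow> 'm) \<Rightarrow> bool" where
  "orthogonal R C A B \<longleftrightarrow>
     (\<forall>r\<in>R. \<forall>c\<in>C. \<forall>r'\<in>R. \<forall>c'\<in>C.
        A r c = A r' c' \<and> B r c = B r' c' \<longrightarrow> (r, c) = (r', c'))"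

definition quadruples ::
  "'r set \<Rightarrow> 'c set \<Rightarrow> ('r \<Rightarrow> 'c \<Rightarrow> 'l) \<Rightarrow> ('r \<Rightarrow> 'c \<Rightarrow> 'm) \<Rightarrow> ('r \<times> 'c \<times> 'l \<times> 'm) set" where
  "quadruples R C A B = {(r, c, A r c, B r c) | r c. r \<in> R \<and> c \<in> C}"

text \<open>The graph $\Gamma(A,B)$, an undirected graph being represented by its symmetric digraph.
  For orthogonal latin squares two distinct quadruples never coincide in more than one position.\<close>

definition ols_graph ::
  "'r set \<Rightarrow> 'c set \<Rightarrow> ('r \<Rightarrow> 'c \<Rightarrow> 'l) \<Rightarrow> ('r \<Rightarrow> 'c \<Rightarrow> 'm) \<Rightarrow> ('r \<times> 'c \<times> 'l \<times> 'm) pair_pre_digraph" where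
  "ols_graph R C A B =
     \<lparr> pverts = quadruples R C A B,
       parcs = {((r, c, a, b), (r', c', a', b')).
          (r, c, a, b) \<in> quadruples R C A B \<and> (r', c', a', b') \<in> quadruples R C A B \<and>
          of_bool (r = r') + of_bool (c = c') + of_bool (a = a') + of_bool (b = b') = (1::nat)} \<rparr>"

definition K44_pattern ::
  "'r set \<Rightarrow> 'c set \<Rightarrow> ('r \<Rightarrow> 'c \<Rightarrow> 'l) \<Rightarrow> ('r \<Rightarrow> 'c \<Rightarrow> 'm) \<Rightarrow> ('r \<times> 'c \<times> 'l \<times> 'm) set \<Rightarrow> bool" where
  "K44_pattern R C A B W \<longleftrightarrow>
     W \<subseteq> quadruples R C A B \<and> card W = 8 \<and>
     complete_bipartite_digraph 4 4 (induce_subgraph (with_proj (ols_graph R C A B)) W)"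

definition K44_free ::
  "'r set \<Rightarrow> 'c set \<Rightarrow> ('r \<Rightarrow> 'c \<Rightarrow> 'l) \<Rightarrow> ('r \<Rightarrow> 'c \<Rightarrow> 'm) \<Rightarrow> bool" where
  "K44_free R C A B \<longleftrightarrow> \<not> (\<exists>W. K44_pattern R C A B W)"

definition linear_fun2 :: "('a, 'z) ring_scheme \<Rightarrow> ('a \<Rightarrow> 'a \<Rightarrow> 'a) \<Rightarrow> bool" where
  "linear_fun2 F f \<longleftrightarrow>
     (\<forall>r\<in>carrier F. \<forall>c\<in>carrier F. f r c \<in> carrier F) \<and>
     (\<forall>r\<in>carrier F. \<forall>c\<in>carrier F. \<forall>r'\<in>carrier F. \<forall>c'\<in>carrier F.
        f (r \<oplus>\<^bsub>F\<^esub> r') (c \<oplus>\<^bsub>F\<^esub> c') = f r c \<oplus>\<^bsub>F\<^esub> f r' c') \<and>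
     (\<forall>k\<in>carrier F. \<forall>r\<in>carrier F. \<forall>c\<in>carrier F.
        f (k \<otimes>\<^bsub>F\<^esub> r) (k \<otimes>\<^bsub>F\<^esub> c) = k \<otimes>\<^bsub>F\<^esub> f r c)"

text \<open>The field \<open>GF(q)\<close> is specified, as usual, only up to isomorphism.\<close>

definition is_GF :: "nat \<Rightarrow> ('a, 'z) ring_scheme \<Rightarrow> bool" where
  "is_GF q F \<longleftrightarrow> field F \<and> finite (carrier F) \<and> order F = q"

definition linear_ols_pair ::
  "nat \<Rightarrow> ('a, 'z) ring_scheme \<Rightarrow> ('a \<Rightarrow> 'a \<Rightarrow> 'a) \<Rightarrow> ('a \<Rightarrow> 'a \<Rightarrow> 'a) \<Rightarrow> bool" where
  "linear_ols_pair q F A B \<longleftrightarrow>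
     is_GF q F \<and>
     latin_square q (carrier F) (carrier F) (carrier F)
       (table_triples (carrier F) (carrier F) A) \<and>
     latin_square q (carrier F) (carrier F) (carrier F)
       (table_triples (carrier F) (carrier F) B) \<and>
     orthogonal (carrier F) (carrier F) A B \<and>
     linear_fun2 F A \<and> linear_fun2 F B"

end

theory Submission
  imports "HOL-Algebra.Algebraic_Closure" "HOL-Number_Theory.Residues" Defs
begin

text \<open>
  Consider the tables \<open>r + c\<close> and \<open>r + l c\<close> with \<open>l \<noteq> 0, 1\<close>, so that a quadruple is a point of the
  affine plane together with its values under four linear forms. In a \<open>K\<^sub>4\<^sub>,\<^sub>4\<close>-pattern, the four
  neighbours of a vertex share four different coordinates with it, so recording the coordinate shared
  by each edge gives a latin square of order 4. For each of its normal forms the edges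
  are linear equations for the eight points. If \<open>2 \<noteq> 0\<close>, the Klein four-group form has no
  nondegenerate solution, and the three cyclic forms have one only if \<open>l\<close> is \<open>1/2\<close>, \<open>-1\<close> or \<open>2\<close>.
  Hence for odd \<open>q\<close> at most five values of \<open>l\<close> are excluded, and one remains if \<open>q \<ge> 7\<close>.

  Conversely, for \<open>2 \<noteq> 0\<close> and \<open>l = -1\<close> the orbit of a point \<open>(v, 1)\<close> under rotation by a right angle
  and its mirror image form a cyclic pattern, provided \<open>v \<noteq> 0, 1, -1\<close>. In characteristic 2 with
  \<open>l = 1 + b\<close>, the additive group generated by \<open>(1 + b\<^sup>2, 1)\<close> and \<open>(1 + b, b)\<close> and its translate by
  \<open>(0, 1)\<close> form a Klein pattern.

  The field with \<open>q = p\<^sup>n\<close> elements is the set of roots of \<open>x\<^sup>q - x\<close> in an algebraic closure of the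
  residue field modulo \<open>p\<close>; the roots are simple because \<open>x\<^sup>q - x = (x - a)\<^sup>q - (x - a)\<close> at a root \<open>a\<close>.
\<close>

no_notation vwalk_join (infixr \<open>\<oplus>\<close> 65)

section \<open>Finite fields\<close>

lemma (in cring) binomial_pow:
  assumes x: "x \<in> carrier R" and y: "y \<in> carrier R"
  shows "(x \<oplus> y) [^] (n::nat) =
    (\<Oplus>k\<in>{..n}. [(n choose k)] \<cdot> (x [^] k \<otimes> y [^] (n - k)))"
proof (induction n)
  case (Suc n)
  let ?f = "\<lambda>k. [(n choose k)] \<cdot> (x [^] Suc k \<otimes> y [^] (n - k))"
  let ?g = "\<lambda>k. [(n choose k)] \<cdot> (x [^] k \<otimes> y [^] (Suc n - k))"
  have xn: "x [^] k \<in> carrier R" "y [^] k \<in> carrier R" for k :: nat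
    using x y by auto
  have f: "?f \<in> A \<rightarrow> carrier R" and g: "?g \<in> A \<rightarrow> carrier R" for A
    using x y by auto
  have 1: "(\<Oplus>k\<in>{..n}. [(n choose k)] \<cdot> (x [^] k \<otimes> y [^] (n - k))) \<otimes> x = (\<Oplus>k\<in>{..n}. ?f k)"
    using x y by (subst finsum_ldistr) (auto intro!: finsum_cong' simp: add_pow_ldistr add_pow_rdistr m_ac)
  have 2: "(\<Oplus>k\<in>{..n}. [(n choose k)] \<cdot> (x [^] k \<otimes> y [^] (n - k))) \<otimes> y = (\<Oplus>k\<in>{..n}. ?g k)"
    using x y
    by (subst finsum_ldistr) (auto intro!: finsum_cong' simp: add_pow_ldistr m_assoc Suc_diff_le)
  \<comment> \<open>The added term has coefficient \<open>n choose Suc n = 0\<close>. With it, the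
    index shift yields a sum over \<open>{..n}\<close> again, which merges with \<open>?f\<close> by
    Pascal's rule.\<close>
  also have "\<dots> = (\<Oplus>k\<in>{..Suc n}. ?g k)"
    using finsum_Suc[OF g, of n] finsum_closed[OF g, of "{..n}"] x y
    by (simp add: binomial_eq_0)
  also have "\<dots> = (\<Oplus>k\<in>{..n}. ?g (Suc k)) \<oplus> ?g 0"
    by (rule finsum_Suc2[OF g])
  finally have "(x \<oplus> y) [^] Suc n = (\<Oplus>k\<in>{..n}. ?f k) \<oplus> ((\<Oplus>k\<in>{..n}. ?g (Suc k)) \<oplus> ?g 0)"
    using Suc 1 x y by (simp add: r_distr del: Suc_diff_Suc)
  also have "\<dots> = (\<Oplus>k\<in>{..n}. ?f k \<oplus> ?g (Suc k)) \<oplus> ?g 0"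
    using x y f by (subst finsum_addf) (auto simp: a_assoc)
  also have "(\<Oplus>k\<in>{..n}. ?f k \<oplus> ?g (Suc k)) =
      (\<Oplus>k\<in>{..n}. [(Suc n choose Suc k)] \<cdot> (x [^] Suc k \<otimes> y [^] (Suc n - Suc k)))"
    using x y by (intro finsum_cong') (auto simp: add.nat_pow_mult)
  also have "\<dots> \<oplus> ?g 0 = (\<Oplus>k\<in>{..Suc n}. [(Suc n choose k)] \<cdot> (x [^] k \<otimes> y [^] (Suc n - k)))"
    using x y by (subst finsum_Suc2) auto
  finally show ?case .
qed (use x y in auto)

text \<open>A prime \<open>p\<close> divides \<open>p choose k\<close> for \<open>0 < k < p\<close>,
  so only the two outer binomial terms survive; iteration gives the exponent \<open>p ^ n\<close>.
  Commutative rings are the right generality because both a field and its polynomial ring are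
  needed.\<close>

lemma (in cring) frobenius_add:
  assumes p: "prime p" and char: "[p] \<cdot> \<one> = \<zero>"
    and x: "x \<in> carrier R" and y: "y \<in> carrier R"
  shows "(x \<oplus> y) [^] (p ^ n :: nat) = x [^] (p ^ n) \<oplus> y [^] (p ^ n)"
proof -
  have z: "[m] \<cdot> a = \<zero>" if "p dvd m" "a \<in> carrier R" for m a
  proof -
    obtain k where k: "m = p * k" using \<open>p dvd m\<close> by auto
    have "[m] \<cdot> a = [k] \<cdot> ([p] \<cdot> (\<one> \<otimes> a))"
      using that by (simp add: k add.nat_pow_pow)
    also have "\<dots> = [k] \<cdot> (([p] \<cdot> \<one>) \<otimes> a)"
      using that add_pow_ldistr[of \<one> a p] by simp
    finally show ?thesis using that by (simp add: char)
  qed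
  have frob: "(x \<oplus> y) [^] p = x [^] p \<oplus> y [^] p"
    if x: "x \<in> carrier R" and y: "y \<in> carrier R" for x y
  proof -
    \<comment> \<open>Writing \<open>p\<close> as \<open>m + 2\<close> allows both outer terms to be
      split off; the middle ones are then indexed by \<open>Suc k\<close> with
      \<open>k \<le> m\<close>.\<close>
    obtain m where m: "p = Suc (Suc m)"
      using prime_ge_2_nat[OF p] by (metis Suc_le_D numeral_2_eq_2 Suc_le_mono)
    let ?f = "\<lambda>k. [(p choose k)] \<cdot> (x [^] k \<otimes> y [^] (p - k))"
    have f: "?f \<in> A \<rightarrow> carrier R" for A
      using x y by auto
    have 0: "(\<Oplus>k\<in>{..m}. ?f (Suc k)) = \<zero>"
      using x y p m by (intro add.finprod_one_eqI z dvd_choose_prime) auto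
    have "(\<Oplus>k\<in>{..p}. ?f k) = ?f p \<oplus> (\<Oplus>k\<in>{..Suc m}. ?f k)"
      unfolding m by (rule finsum_Suc[OF f[unfolded m]])
    also have "(\<Oplus>k\<in>{..Suc m}. ?f k) = (\<Oplus>k\<in>{..m}. ?f (Suc k)) \<oplus> ?f 0"
      by (rule finsum_Suc2[OF f])
    finally show ?thesis
      unfolding binomial_pow[OF x y] 0 using x y by simp
  qed
  show ?thesis
  proof (induction n)
    case (Suc n)
    have "(x \<oplus> y) [^] (p ^ Suc n) = ((x \<oplus> y) [^] (p ^ n)) [^] p"
      using x y by (simp add: nat_pow_pow mult.commute)
    also have "\<dots> = x [^] (p ^ Suc n) \<oplus> y [^] (p ^ Suc n)"
      using x y by (simp add: Suc frob nat_pow_pow mult.commute)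
    finally show ?case .
  qed (use x y in simp)
qed


lemma (in field) frobenius_fixed_subfield:
  assumes p: "prime p" and char: "[p] \<cdot> \<one> = \<zero>"
  shows "subfield {x \<in> carrier R. x [^] (p ^ n :: nat) = x} R"
proof (rule subfieldI'[OF subringI])
  let ?S = "{x \<in> carrier R. x [^] (p ^ n :: nat) = x}"
  have pos: "p ^ n > 0"
    using p by (simp add: prime_gt_0_nat)
  show "\<ominus> h \<in> ?S" if "h \<in> ?S" for h
  proof -
    \<comment> \<open>Additivity yields the power of \<open>\<ominus> h\<close> without separating
      even from odd exponents.\<close>
    have "h \<oplus> (\<ominus> h) [^] (p ^ n) = (h \<oplus> \<ominus> h) [^] (p ^ n)"
      using that frobenius_add[OF p char, of h "\<ominus> h" n] by simp
    also have "\<dots> = \<zero>"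
      using that pos by (simp add: r_neg nat_pow_zero)
    finally show ?thesis
      using that by (auto intro!: minus_equality[symmetric] simp: a_comm)
  qed
  show "h1 \<oplus> h2 \<in> ?S" if "h1 \<in> ?S" "h2 \<in> ?S" for h1 h2
    using that frobenius_add[OF p char, of h1 h2 n] by simp
  show "h1 \<otimes> h2 \<in> ?S" if "h1 \<in> ?S" "h2 \<in> ?S" for h1 h2
    using that by (simp add: nat_pow_distrib)
  show "inv k \<in> ?S" if "k \<in> ?S - {\<zero>}" for k
  proof -
    have k: "k \<in> Units R"
      using that field_Units by auto
    have "k \<otimes> inv k [^] (p ^ n) = k [^] (p ^ n) \<otimes> inv k [^] (p ^ n)"
      using that by simp
    also have "\<dots> = \<one>"
      using k by (subst nat_pow_distrib[symmetric]) auto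
    finally have "inv k = inv k [^] (p ^ n)"
      using k by (intro comm_inv_char) auto
    then show ?thesis using k by simp
  qed
qed auto

section \<open>The polynomial \<open>X^q - X\<close> and its roots\<close>

lemma ring_hom_add_pow_one:
  assumes "ring R" "ring S" "h \<in> ring_hom R S"
  shows "h ([(n::nat)] \<cdot>\<^bsub>R\<^esub> \<one>\<^bsub>R\<^esub>) = [n] \<cdot>\<^bsub>S\<^esub> \<one>\<^bsub>S\<^esub>"
proof -
  interpret ring_hom_ring R S h
    using assms by (intro ring_hom_ringI2)
  show ?thesis
    by (induction n) auto
qed

text \<open>Coefficient lists start with the leading coefficient, so
  \<open>[\<ominus> \<one>, \<zero>]\<close> is \<open>-X\<close>. The list form serves for degree,
  evaluation and splitting, the last equation for computing in the polynomial ring.\<close>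

lemma (in domain) var_pow_minus_var:
  assumes K: "subring K R" and n: "n \<ge> 2"
  defines "P \<equiv> poly_add (monom \<one> n) [\<ominus> \<one>, \<zero>]"
  shows "P \<in> carrier (K[X])" "length P = Suc n"
    "x \<in> carrier R \<Longrightarrow> eval P x = x [^] n \<ominus> x"
    "P = X [^]\<^bsub>poly_ring R\<^esub> n \<ominus>\<^bsub>poly_ring R\<^esub> X"
proof -
  have m: "polynomial K (monom \<one> n)"
    using subringE(3)[OF K] by (intro monom_is_polynomial[OF K]) auto
  have v: "polynomial K [\<ominus> \<one>, \<zero>]"
    unfolding polynomial_def using subringE[OF K] by (auto simp: add.inv_eq_1_iff)
  show "P \<in> carrier (K[X])"
    unfolding P_def univ_poly_carrier[symmetric] using poly_add_closed[OF K m v] .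
  show "length P = Suc n"
    \<comment> \<open>As \<open>n \<ge> 2\<close>, the two summands have different lengths and no
      leading coefficients can cancel.\<close>
    unfolding P_def using n by (subst poly_add_length_eq[OF K m v]) (auto simp: monom_def)
  show "eval P x = x [^] n \<ominus> x" if x: "x \<in> carrier R"
  proof -
    have "eval P x = eval (monom \<one> n) x \<oplus> eval [\<ominus> \<one>, \<zero>] x"
      unfolding P_def by (rule eval_poly_add) (use x monom_in_carrier[of \<one> n] in auto)
    then show ?thesis
      using x by (simp add: eval_monom l_minus a_minus_def)
  qed
  show "P = X [^]\<^bsub>poly_ring R\<^esub> n \<ominus>\<^bsub>poly_ring R\<^esub> X"
    unfolding P_def a_minus_def univ_poly_add
      univ_poly_a_inv_def'[OF carrier_is_subring var_closed(1)[OF carrier_is_subring]]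
      unitary_monom_eq_var_pow[OF carrier_is_subring]
    by (simp add: var_def)
qed

text \<open>Cancelling one factor \<open>y\<close> leaves \<open>y^(m+1) - 1 = y r\<close>, hence
  \<open>1 = y (y^m - r)\<close>. This takes the place of a derivative when roots are shown to be
  simple.\<close>

lemma (in domain) divides_one_if_square_divides:
  assumes y: "y \<in> carrier R" "y \<noteq> \<zero>" and r: "r \<in> carrier R"
    and eq: "y [^] Suc (Suc m) \<ominus> y = y [^] (2::nat) \<otimes> r"
  shows "y divides \<one>"
proof -
  define t where "t = y [^] m"
  have t: "t \<in> carrier R"
    using y by (simp add: t_def)
  have "t \<otimes> y \<otimes> y = (t \<otimes> y \<otimes> y \<ominus> y) \<oplus> y"
    using y t by algebra
  also have "t \<otimes> y \<otimes> y \<ominus> y = y \<otimes> y \<otimes> r"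
    using eq y r by (simp add: t_def numeral_2_eq_2)
  finally have "y \<otimes> (y \<otimes> (t \<ominus> r)) = (y \<otimes> y \<otimes> r \<oplus> y) \<ominus> y \<otimes> y \<otimes> r"
    using y r t by (simp add: r_distr l_distr r_minus a_minus_def m_ac)
  also have "\<dots> = y \<otimes> \<one>"
    using y r by algebra
  finally have "y \<otimes> (y \<otimes> (t \<ominus> r)) = y \<otimes> \<one>" .
  then have "\<one> = y \<otimes> (t \<ominus> r)"
    using y r t by (subst (asm) m_lcancel) auto
  then show ?thesis
    using r t by (auto simp: factor_def)
qed

text \<open>Put \<open>Y = X - a\<close> and \<open>q = p ^ n\<close>. Since \<open>-a\<close> is
  also fixed by the Frobenius power, \<open>Y^q - Y = X^q - X\<close>. If \<open>Y^2\<close> divided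
  this, then \<open>Y\<close> would divide \<open>1\<close>, which does not vanish at
  \<open>a\<close>.\<close>

lemma (in field) var_pow_minus_var_simple_roots:
  assumes p: "prime (p::nat)" and char: "[p] \<cdot> \<one> = \<zero>" and n: "n > 0"
    and a: "a \<in> carrier R" "a [^] (p ^ n) = a"
  shows "\<not> [\<one>, \<ominus> a] [^]\<^bsub>poly_ring R\<^esub> (2::nat) pdivides
     (X [^]\<^bsub>poly_ring R\<^esub> (p ^ n) \<ominus>\<^bsub>poly_ring R\<^esub> X)"
proof
  interpret UP: domain "poly_ring R"
    using univ_poly_is_domain[OF carrier_is_subring] .
  interpret C: ring_hom_ring R "poly_ring R" poly_of_const
    using canonical_embedding_ring_hom[OF carrier_is_subring] by simp
  let ?Y = "[\<one>, \<ominus> a]" and ?c = "poly_of_const (\<ominus> a)"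
  have "\<ominus> a \<in> {x \<in> carrier R. x [^] (p ^ n) = x}"
    using subringE(5)[OF subfieldE(1)[OF frobenius_fixed_subfield[OF p char]], of a n] a by simp
  then have b: "\<ominus> a \<in> carrier R" "(\<ominus> a) [^] (p ^ n) = \<ominus> a" by auto
  have c: "?c \<in> carrier (poly_ring R)" "?c [^]\<^bsub>poly_ring R\<^esub> (p ^ n) = ?c"
    using C.hom_closed[OF b(1)] C.hom_nat_pow[OF b(1), of "p ^ n"] b(2) by auto
  have X: "X \<in> carrier (poly_ring R)"
    by (rule var_closed[OF carrier_is_subring])
  have Y: "?Y = X \<oplus>\<^bsub>poly_ring R\<^esub> ?c"
    using a by (auto simp: var_def poly_of_const_def univ_poly_add)
  then have Yc: "?Y \<in> carrier (poly_ring R)"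
    using X c by simp
  have charP: "[p] \<cdot>\<^bsub>poly_ring R\<^esub> \<one>\<^bsub>poly_ring R\<^esub> = \<zero>\<^bsub>poly_ring R\<^esub>"
    using ring_hom_add_pow_one[OF ring_axioms UP.ring_axioms C.homh, of p] char by simp
  define m where "m = p ^ n - 2"
  have "p \<le> p ^ n"
    using prime_ge_2_nat[OF p] n by (intro self_le_power) auto
  then have m: "p ^ n = Suc (Suc m)"
    using prime_ge_2_nat[OF p] by (simp add: m_def)
  assume "?Y [^]\<^bsub>poly_ring R\<^esub> (2::nat) pdivides
     (X [^]\<^bsub>poly_ring R\<^esub> (p ^ n) \<ominus>\<^bsub>poly_ring R\<^esub> X)"
  then obtain r where r: "r \<in> carrier (poly_ring R)"
    "X [^]\<^bsub>poly_ring R\<^esub> (p ^ n) \<ominus>\<^bsub>poly_ring R\<^esub> X = ?Y [^]\<^bsub>poly_ring R\<^esub> (2::nat) \<otimes>\<^bsub>poly_ring R\<^esub> r"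
    unfolding pdivides_def factor_def by auto
  have Yq: "?Y [^]\<^bsub>poly_ring R\<^esub> (p ^ n) = X [^]\<^bsub>poly_ring R\<^esub> (p ^ n) \<oplus>\<^bsub>poly_ring R\<^esub> ?c"
    unfolding Y UP.frobenius_add[OF p charP X c(1)] c(2) ..
  \<comment> \<open>Adding the constant \<open>-a\<close> to both terms of \<open>X^q - X\<close>
    turns them into \<open>Y^q\<close> and \<open>Y\<close>.\<close>
  have cancel: "u \<ominus>\<^bsub>poly_ring R\<^esub> v = (u \<oplus>\<^bsub>poly_ring R\<^esub> w) \<ominus>\<^bsub>poly_ring R\<^esub> (v \<oplus>\<^bsub>poly_ring R\<^esub> w)"
    if "u \<in> carrier (poly_ring R)" "v \<in> carrier (poly_ring R)" "w \<in> carrier (poly_ring R)" for u v w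
    using that by algebra
  have "X [^]\<^bsub>poly_ring R\<^esub> (p ^ n) \<ominus>\<^bsub>poly_ring R\<^esub> X =
      ?Y [^]\<^bsub>poly_ring R\<^esub> (p ^ n) \<ominus>\<^bsub>poly_ring R\<^esub> ?Y"
    unfolding cancel[OF UP.nat_pow_closed[OF X] X c(1)] unfolding Yq[symmetric] Y[symmetric] ..
  then have "?Y [^]\<^bsub>poly_ring R\<^esub> (p ^ n) \<ominus>\<^bsub>poly_ring R\<^esub> ?Y = ?Y [^]\<^bsub>poly_ring R\<^esub> (2::nat) \<otimes>\<^bsub>poly_ring R\<^esub> r"
    using r by simp
  then have "?Y divides\<^bsub>poly_ring R\<^esub> \<one>\<^bsub>poly_ring R\<^esub>"
    unfolding m by (rule UP.divides_one_if_square_divides[OF Yc _ r(1), rotated])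
      (simp add: univ_poly_zero)
  then have "?Y pdivides [\<one>]"
    by (simp add: pdivides_def univ_poly_one)
  then have "eval [\<one>] a = \<zero>"
    by (rule pdivides_imp_root_sharing[OF Yc]) (use a in \<open>auto simp: r_neg\<close>)
  then show False
    using a by simp
qed

text \<open>Splitting gives \<open>q\<close> roots counted with multiplicity, simplicity makes them
  distinct, and being Frobenius fixed points they form a subfield.\<close>

lemma exists_GF:
  assumes "primepow q"
  shows "\<exists>F :: nat ring. field F \<and> finite (carrier F) \<and> order F = q"
proof -
  obtain p n where p: "prime p" and n: "n > 0" and q: "q = p ^ n"
    using assms unfolding primepow_def by auto
  interpret R: residues_prime p "residue_ring (int p)"
    by unfold_locales (use p in auto)
  obtain L :: "((int list \<times> nat) multiset \<Rightarrow> int) ring" where L: "algebraic_closure L (R.indexed_const ` carrier (residue_ring (int p)))"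
    and h: "R.indexed_const \<in> ring_hom (residue_ring (int p)) L"
    using R.exists_closure .
  let ?K = "R.indexed_const ` carrier (residue_ring (int p))"
  interpret L: algebraic_closure L ?K by (rule L)
  have char: "[p] \<cdot>\<^bsub>L\<^esub> \<one>\<^bsub>L\<^esub> = \<zero>\<^bsub>L\<^esub>"
  proof -
    have "[k] \<cdot>\<^bsub>residue_ring (int p)\<^esub> \<one>\<^bsub>residue_ring (int p)\<^esub> = int k mod int p" for k :: nat
      by (induction k) (auto simp: R.res_add_eq R.res_zero_eq R.res_one_eq mod_simps add.commute)
    then show ?thesis
      using ring_hom_add_pow_one[OF R.ring_axioms L.ring_axioms h, of p]
        ring_hom_zero[OF h R.ring_axioms L.ring_axioms] by (simp add: R.res_zero_eq)
  qed
  have K: "subring ?K L"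
    by (intro subfieldE(1) L.subfield_axioms)
  have q2: "q \<ge> 2"
    unfolding q using prime_ge_2_nat[OF p] n
    by (metis One_nat_def Suc_1 Suc_leD order_trans self_le_power)
  define P where "P = L.poly_add (L.monom \<one>\<^bsub>L\<^esub> q) [\<ominus>\<^bsub>L\<^esub> \<one>\<^bsub>L\<^esub>, \<zero>\<^bsub>L\<^esub>]"
  note P = L.var_pow_minus_var[OF K q2, folded P_def]
  let ?S = "{x \<in> carrier L. x [^]\<^bsub>L\<^esub> q = x}"
  \<comment> \<open>Splitting is known for polynomials over the prime field \<open>?K\<close>, while
    multiplicities are counted over \<open>L\<close>; hence both memberships.\<close>
  have PL: "P \<in> carrier (poly_ring L)"
    using L.carrier_polynomial[OF K] P(1) unfolding univ_poly_carrier[symmetric] by blast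
  have P0: "P \<noteq> []" using P(2) by auto
  have "L.is_root P x \<longleftrightarrow> x \<in> ?S" for x
  proof (cases "x \<in> carrier L")
    case True
    then show ?thesis
      using P(3)[OF True] P0 L.r_right_minus_eq[OF L.nat_pow_closed[OF True] True, of q]
      by (auto simp: L.is_root_def)
  qed (auto simp: L.is_root_def)
  then have S: "set_mset (L.roots P) = ?S"
    using L.roots_mem_iff_is_root[OF PL] by blast
  have "count (L.roots P) x = 1" if "x \<in> ?S" for x
  proof -
    have "\<not> [\<one>\<^bsub>L\<^esub>, \<ominus>\<^bsub>L\<^esub> x] [^]\<^bsub>poly_ring L\<^esub> (2::nat) pdivides\<^bsub>L\<^esub> P"
      using L.var_pow_minus_var_simple_roots[OF p char n, of x] that unfolding P(4) q by simp
    then have "\<not> 2 \<le> count (L.roots P) x"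
      using L.le_alg_mult_imp_pdivides[OF _ PL, of x 2] that
      by (auto simp: L.alg_mult_eq_count_roots[OF PL])
    moreover have "count (L.roots P) x > 0"
      using that S by (metis count_greater_zero_iff)
    ultimately show ?thesis by linarith
  qed
  then have "size (L.roots P) = card ?S"
    by (simp add: size_multiset_overloaded_eq S)
  moreover have "size (L.roots P) = q"
    using L.roots_over_subfield[OF P(1)] P(2) by (simp add: L.splitted_def)
  ultimately have card: "card ?S = q" by simp
  have fin: "finite ?S"
    using S by (metis finite_set_mset)
  have "subfield ?S L"
    unfolding q by (rule L.frobenius_fixed_subfield[OF p char])
  then interpret S: field "L\<lparr>carrier := ?S\<rparr>"
    by (rule L.subfield_iff)
  \<comment> \<open>The elements of \<open>L\<close> have a complicated type. A finite field can be
    copied into the natural numbers along any injection.\<close>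
  obtain f :: "_ \<Rightarrow> nat" where f: "inj_on f ?S"
    using finite_imp_inj_to_nat_seg[OF fin] by auto
  show ?thesis
  proof (intro exI conjI)
    show "field (image_ring f (L\<lparr>carrier := ?S\<rparr>))"
      by (rule S.inj_imp_image_ring_is_field) (use f in simp)
  qed (use fin f card in \<open>auto simp: image_ring_carrier order_def card_image\<close>)
qed

section \<open>Latin squares of order 4\<close>

lemma all_less_4: "(\<forall>i<4. P i) \<longleftrightarrow> P 0 \<and> P 1 \<and> P 2 \<and> P (3::nat)"
  by (auto simp: numeral_eq_Suc less_Suc_eq)

text \<open>There are four reduced squares. The entry \<open>M 1 1\<close> separates them, except
  that \<open>M 1 1 = 0\<close> leaves two, told apart by \<open>M 2 2\<close>: one is the Klein
  table, the other three are cyclic. The list \<open>f\<close> orders the symbols so that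
  \<open>M\<close> becomes addition of positions modulo 4.\<close>

lemma reduced_latin_square_4:
  fixes M :: "nat \<Rightarrow> nat \<Rightarrow> nat"
  assumes lt: "\<And>i j. i < 4 \<Longrightarrow> j < 4 \<Longrightarrow> M i j < 4"
    and row: "\<And>i j j'. i < 4 \<Longrightarrow> j < 4 \<Longrightarrow> j' < 4 \<Longrightarrow> M i j = M i j' \<Longrightarrow> j = j'"
    and col: "\<And>i i' j. i < 4 \<Longrightarrow> i' < 4 \<Longrightarrow> j < 4 \<Longrightarrow> M i j = M i' j \<Longrightarrow> i = i'"
    and M0: "\<And>j. j < 4 \<Longrightarrow> M 0 j = j" "\<And>i. i < 4 \<Longrightarrow> M i 0 = i"
  shows "(\<forall>i<4. \<forall>j<4. M i j = [[0,1,2,3],[1,0,3,2],[2,3,0,1],[3,2,1,0]] ! i ! j) \<or>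
    (\<exists>f\<in>{[0,1,2,3],[0,2,1,3],[0,1,3,2]}. \<forall>i<4. \<forall>j<4. M (f ! i) (f ! j) = f ! ((i + j) mod 4))"
proof -
  have less4: "k = 0 \<or> k = 1 \<or> k = 2 \<or> k = 3" if "k < 4" for k :: nat
    using that by arith
  have r: "M i 0 = i" "M i 1 \<noteq> i" "M i 2 \<noteq> i" "M i 3 \<noteq> i" "M i 1 \<noteq> M i 2" "M i 1 \<noteq> M i 3" "M i 2 \<noteq> M i 3"
    if "i < 4" for i
    using row[OF that, of 1 2] row[OF that, of 1 3] row[OF that, of 2 3]
      row[OF that, of 1 0] row[OF that, of 2 0] row[OF that, of 3 0] M0(2)[OF that] by auto
  have c: "M 0 i = i" "M 1 i \<noteq> i" "M 2 i \<noteq> i" "M 3 i \<noteq> i" "M 1 i \<noteq> M 2 i" "M 1 i \<noteq> M 3 i" "M 2 i \<noteq> M 3 i"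
    if "i < 4" for i
    using col[OF _ _ that, of 1 2] col[OF _ _ that, of 1 3] col[OF _ _ that, of 2 3]
      col[OF _ _ that, of 1 0] col[OF _ _ that, of 2 0] col[OF _ _ that, of 3 0] M0(1)[OF that] by auto
  have l: "M i j \<in> {0,1,2,3}" if "i < 4" "j < 4" for i j
    using less4[OF lt[OF that]] by auto
  have e: "M 1 1 \<in> {0,2,3}" "M 1 2 \<in> {0,3}" "M 1 3 \<in> {0,2}" "M 2 1 \<in> {0,3}" "M 3 1 \<in> {0,2}"
    "M 2 2 \<in> {0,1,3}" "M 2 3 \<in> {0,1}" "M 3 2 \<in> {0,1}" "M 3 3 \<in> {0,1,2}"
    using l[of 1 1] l[of 1 2] l[of 1 3] l[of 2 1] l[of 2 2] l[of 2 3] l[of 3 1] l[of 3 2] l[of 3 3]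
      r(2-4)[of 1] r(2-4)[of 2] r(2-4)[of 3] c(2-4)[of 1] c(2-4)[of 2] c(2-4)[of 3]
    by simp_all
  note M00 = M0(1)[of 0] M0(1)[of 1] M0(1)[of 2] M0(1)[of 3] M0(2)[of 1] M0(2)[of 2] M0(2)[of 3]
  \<comment> \<open>With \<open>M 1 1 = 0\<close>, the entry \<open>M 1 2\<close> must be 3, so
    column 2 has no other 3.\<close>
  have "M 1 1 = 0 \<Longrightarrow> M 2 2 \<noteq> 3"
    using e(2) r(5)[of 1] c(5)[of 2] by auto
  then consider "M 1 1 = 0" "M 2 2 = 0" | "M 1 1 = 0" "M 2 2 = 1" | "M 1 1 = 2" | "M 1 1 = 3"
    using e(1) e(6) by auto
  then show ?thesis
  proof cases
    case 1
    have m12: "M 1 2 = 3" using e(2) r(5)[of 1] 1 by auto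
    have m13: "M 1 3 = 2" using e(3) r(6)[of 1] 1 by auto
    have m21: "M 2 1 = 3" using e(4) c(5)[of 1] 1 by auto
    have m31: "M 3 1 = 2" using e(5) c(6)[of 1] 1 by auto
    have m23: "M 2 3 = 1" using e(7) r(7)[of 2] 1 by auto
    have m32: "M 3 2 = 1" using e(8) c(7)[of 2] 1 by auto
    have m33: "M 3 3 = 0" using e(9) r(6)[of 3] r(7)[of 3] m31 m32 by auto
    show ?thesis
      using 1 m12 m13 m21 m31 m23 m32 m33 M00 by (simp add: all_less_4)
  next
    case 2
    have m12: "M 1 2 = 3" using e(2) r(5)[of 1] 2 by auto
    have m13: "M 1 3 = 2" using e(3) r(6)[of 1] 2 by auto
    have m21: "M 2 1 = 3" using e(4) c(5)[of 1] 2 by auto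
    have m31: "M 3 1 = 2" using e(5) c(6)[of 1] 2 by auto
    have m23: "M 2 3 = 0" using e(7) r(7)[of 2] 2 by auto
    have m32: "M 3 2 = 0" using e(8) c(7)[of 2] 2 by auto
    have m33: "M 3 3 = 1" using e(9) r(6)[of 3] r(7)[of 3] m31 m32 by auto
    show ?thesis
      using 2 m12 m13 m21 m31 m23 m32 m33 M00 by (simp add: all_less_4)
  next
    case 3
    have m13: "M 1 3 = 0" using e(3) r(6)[of 1] 3 by auto
    have m12: "M 1 2 = 3" using e(2) r(7)[of 1] m13 by auto
    have m31: "M 3 1 = 0" using e(5) c(6)[of 1] 3 by auto
    have m21: "M 2 1 = 3" using e(4) c(7)[of 1] m31 by auto
    have m23: "M 2 3 = 1" using e(7) c(5)[of 3] m13 by auto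
    have m32: "M 3 2 = 1" using e(8) r(5)[of 3] m31 by auto
    have m22: "M 2 2 = 0" using e(6) r(5)[of 2] r(7)[of 2] m21 m23 by auto
    have m33: "M 3 3 = 2" using e(9) r(6)[of 3] r(7)[of 3] m31 m32 by auto
    show ?thesis
      using 3 m13 m12 m31 m21 m23 m32 m22 m33 M00 by (simp add: all_less_4)
  next
    case 4
    have m12: "M 1 2 = 0" using e(2) r(5)[of 1] 4 by auto
    have m21: "M 2 1 = 0" using e(4) c(5)[of 1] 4 by auto
    have m13: "M 1 3 = 2" using e(3) r(7)[of 1] m12 by auto
    have m31: "M 3 1 = 2" using e(5) c(7)[of 1] m21 by auto
    have m23: "M 2 3 = 1" using e(7) r(6)[of 2] m21 by auto
    have m32: "M 3 2 = 1" using e(8) c(6)[of 2] m12 by auto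
    have m22: "M 2 2 = 3" using e(6) r(5)[of 2] r(7)[of 2] m21 m23 by auto
    have m33: "M 3 3 = 0" using e(9) r(6)[of 3] r(7)[of 3] m31 m32 by auto
    show ?thesis
      using 4 m12 m21 m13 m31 m23 m32 m22 m33 M00 by (simp add: all_less_4)
  qed
qed

text \<open>Up to relabelling, a latin square of order 4 is the Klein four-group table or a cyclic table
  with symbols \<open>f ! 0, \<dots>, f ! 3\<close> in cyclic order. The symbols will be the four coordinates, which
  are not interchangeable, so the three cyclic orders have to be kept apart.\<close>

lemma latin_square_4_normal_form:
  fixes L :: "'a \<Rightarrow> 'b \<Rightarrow> nat"
  assumes card: "card U = 4" "card V = 4"
    and lt: "\<And>p q. p \<in> U \<Longrightarrow> q \<in> V \<Longrightarrow> L p q < 4"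
    and row: "\<And>p. p \<in> U \<Longrightarrow> inj_on (L p) V"
    and col: "\<And>q. q \<in> V \<Longrightarrow> inj_on (\<lambda>p. L p q) U"
  obtains p q where "p ` {..<4} \<subseteq> U" "inj_on p {..<4}" "q ` {..<4} \<subseteq> V"
    "(\<forall>i<4. \<forall>j<4. L (p i) (q j) = [[0,1,2,3],[1,0,3,2],[2,3,0,1],[3,2,1,0]] ! i ! j) \<or>
     (\<exists>f\<in>{[0,1,2,3],[0,2,1,3],[0,1,3,2]}. \<forall>i<4. \<forall>j<4. L (p i) (q j) = f ! ((i + j) mod 4))"
proof -
  have bij: "bij_betw g Z {..<4}"
    if "inj_on g Z" "g ` Z \<subseteq> {..<4}" "card Z = 4" for g :: "'z \<Rightarrow> nat" and Z
    using that by (simp add: bij_betw_def card_image card_subset_eq)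
  obtain p0 where p0: "p0 \<in> U"
    using card by fastforce
  \<comment> \<open>Columns are named after the symbols in row \<open>p0\<close>, then rows after
    the symbols in column \<open>q 0\<close>; this makes the table reduced.\<close>
  define q where "q = inv_into V (L p0)"
  have Lp0: "bij_betw (L p0) V {..<4}"
    using row[OF p0] lt[OF p0] card by (intro bij) auto
  have q: "q j \<in> V" "L p0 (q j) = j" if "j < 4" for j
    using that bij_betwE[OF bij_betw_inv_into[OF Lp0]] bij_betw_inv_into_right[OF Lp0]
    by (auto simp: q_def)
  define p where "p = inv_into U (\<lambda>p. L p (q 0))"
  have Lq0: "bij_betw (\<lambda>p. L p (q 0)) U {..<4}"
    using col[of "q 0"] q(1)[of 0] lt card by (intro bij) auto
  have p: "p i \<in> U" "L (p i) (q 0) = i" if "i < 4" for i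
    using that bij_betwE[OF bij_betw_inv_into[OF Lq0]] bij_betw_inv_into_right[OF Lq0]
    by (auto simp: p_def)
  \<comment> \<open>Both rows carry the symbol 0 in column \<open>q 0\<close>. Hence row 0 of
    \<open>M\<close> is the row used to name the columns.\<close>
  have "p 0 = p0"
    by (rule inj_onD[OF bij_betw_imp_inj_on[OF Lq0]]) (use p[of 0] q[of 0] p0 in auto)
  have inj_p: "inj_on p {..<4}"
    using p(2) by (metis inj_onI lessThan_iff)
  have inj_q: "inj_on q {..<4}"
    using q(2) by (metis inj_onI lessThan_iff)
  define M where "M = (\<lambda>i j. L (p i) (q j))"
  have "(\<forall>i<4. \<forall>j<4. M i j = [[0,1,2,3],[1,0,3,2],[2,3,0,1],[3,2,1,0]] ! i ! j) \<or>
    (\<exists>f\<in>{[0,1,2,3],[0,2,1,3],[0,1,3,2]}. \<forall>i<4. \<forall>j<4. M (f ! i) (f ! j) = f ! ((i + j) mod 4))"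
  proof (rule reduced_latin_square_4)
    show "j = j'" if "i < 4" "j < 4" "j' < 4" "M i j = M i j'" for i j j'
      using that inj_onD[OF row[OF p(1)], of i "q j" "q j'"] q(1) inj_onD[OF inj_q, of j j']
      by (simp add: M_def)
    show "i = i'" if "i < 4" "i' < 4" "j < 4" "M i j = M i' j" for i i' j
      using that inj_onD[OF col[OF q(1)], of j "p i" "p i'"] p(1) inj_onD[OF inj_p, of i i']
      by (simp add: M_def)
  qed (use p q lt \<open>p 0 = p0\<close> in \<open>auto simp: M_def\<close>)
  then consider "\<forall>i<4. \<forall>j<4. M i j = [[0,1,2,3],[1,0,3,2],[2,3,0,1],[3,2,1,0]] ! i ! j"
    | f where "f \<in> {[0,1,2,3],[0,2,1,3],[0,1,3,2]}"
      "\<forall>i<4. \<forall>j<4. M (f ! i) (f ! j) = f ! ((i + j) mod 4)"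
    by blast
  then show ?thesis
  proof cases
    case 1
    then show ?thesis
      using p(1) q(1) inj_p by (intro that[of p q]) (auto simp: M_def)
  next
    case 2
    have f: "f ! i < 4" if "i < 4" for i
      using 2(1) that by (auto simp: numeral_eq_Suc less_Suc_eq)
    have inj_f: "inj_on ((!) f) {..<4}"
      using 2(1) by (auto simp: inj_on_def numeral_eq_Suc less_Suc_eq)
    show ?thesis
    \<comment> \<open>Permuting rows and columns alike by \<open>f\<close> makes the entry depend on
      \<open>i + j\<close> modulo 4 only.\<close>
    proof (rule that[of "\<lambda>i. p (f ! i)" "\<lambda>i. q (f ! i)"])
      show "inj_on (\<lambda>i. p (f ! i)) {..<4}"
        using inj_f inj_p f by (auto simp: inj_on_def)
    qed (use p(1) q(1) 2 f in \<open>auto simp: M_def simp del: insert_iff\<close>)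
  qed
qed

section \<open>Patterns\<close>

lemma latin_square_table_triples:
  assumes fin: "finite R" "finite C" "finite L"
    and card: "card R = n" "card C = n" "card L = n"
    and closed: "\<And>r c. r \<in> R \<Longrightarrow> c \<in> C \<Longrightarrow> S r c \<in> L"
    and row: "\<And>r. r \<in> R \<Longrightarrow> inj_on (S r) C"
    and col: "\<And>c. c \<in> C \<Longrightarrow> inj_on (\<lambda>r. S r c) R"
  shows "latin_square n R C L (table_triples R C S)"
proof -
  have T: "table_triples R C S = (\<lambda>(r, c). (r, c, S r c)) ` (R \<times> C)"
    by (auto simp: table_triples_def)
  have "card (table_triples R C S) = n\<^sup>2"
    unfolding T by (subst card_image) (auto simp: inj_on_def card_cartesian_product card power2_eq_square)
  moreover have "of_bool (r \<noteq> r') + of_bool (c \<noteq> c') + of_bool (S r c \<noteq> S r' c') \<noteq> (1::nat)"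
    if "r \<in> R" "c \<in> C" "r' \<in> R" "c' \<in> C" for r c r' c'
    using that inj_onD[OF row[of r], of c c'] inj_onD[OF col[of c], of r r'] by auto
  ultimately show ?thesis
    unfolding latin_square_def using fin card closed by (auto simp: table_triples_def)
qed

text \<open>Positions are numbers so that the position shared by the ends of an edge can serve as a
  symbol of a latin square.\<close>

definition coord :: "nat \<Rightarrow> 'a \<times> 'a \<times> 'a \<times> 'a \<Rightarrow> 'a" where
  "coord k p = (case p of (r, c, a, b) \<Rightarrow> [r, c, a, b] ! k)"

lemma coord_simps [simp]:
  "coord 0 (r, c, a, b) = r" "coord (Suc 0) (r, c, a, b) = c"
  "coord 2 (r, c, a, b) = a" "coord 3 (r, c, a, b) = b"
  by (simp_all add: coord_def)

text \<open>Links the sum of truth values that defines adjacency with the one coordinate shared by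
  an edge.\<close>

lemma ex1_less_4:
  "(\<exists>!k::nat. k < 4 \<and> P k) \<longleftrightarrow>
     of_bool (P 0) + of_bool (P 1) + of_bool (P 2) + of_bool (P 3) = (1::nat)"
proof -
  have "(\<exists>!k::nat. k < 4 \<and> P k) \<longleftrightarrow> \<not> (\<forall>k<4. \<not> (P k \<and> (\<forall>j<4. P j \<longrightarrow> j = k)))"
    by blast
  also have "\<dots> \<longleftrightarrow> of_bool (P 0) + of_bool (P 1) + of_bool (P 2) + of_bool (P 3) = (1::nat)"
    unfolding all_less_4 by (cases "P 0"; cases "P 1"; cases "P 2"; cases "P 3") simp_all
  finally show ?thesis .
qed

lemma parcs_ols_graph_iff:
  "(p, q) \<in> parcs (ols_graph R C A B) \<longleftrightarrow> p \<in> quadruples R C A B \<and> q \<in> quadruples R C A B \<and>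
     (\<exists>!k. k < 4 \<and> coord k p = coord k q)"
  unfolding ex1_less_4 by (cases p; cases q) (simp add: ols_graph_def)

lemma eq_bipartite_relation_iff:
  assumes "\<And>p q. (p, q) \<in> E \<longleftrightarrow> p \<in> W \<and> q \<in> W \<and> Q p q" and "W = U \<union> V"
  shows "E = U \<times> V \<union> V \<times> U \<longleftrightarrow> (\<forall>p\<in>W. \<forall>q\<in>W. Q p q \<longleftrightarrow> (p, q) \<in> U \<times> V \<union> V \<times> U)"
  by (simp add: set_eq_iff assms) blast

text \<open>Replaces the digraph by coincidences of coordinates, the form in which patterns are both
  built and refuted below.\<close>

lemma K44_pattern_iff:
  fixes R C :: "'a set" and A B :: "'a \<Rightarrow> 'a \<Rightarrow> 'a"
  shows "K44_pattern R C A B W \<longleftrightarrow> W \<subseteq> quadruples R C A B \<and> (\<exists>U V. W = U \<union> V \<and> U \<inter> V = {} \<and>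
     card U = 4 \<and> card V = 4 \<and>
     (\<forall>p\<in>W. \<forall>q\<in>W. (\<exists>!k. k < 4 \<and> coord k p = coord k q) \<longleftrightarrow> (p, q) \<in> U \<times> V \<union> V \<times> U))"
proof -
  let ?H = "\<lparr> pverts = W, parcs = {e \<in> parcs (ols_graph R C A B). fst e \<in> W \<and> snd e \<in> W} \<rparr>"
  have H: "induce_subgraph (with_proj (ols_graph R C A B)) W = with_proj ?H"
    by (simp add: induce_subgraph_def with_proj_def)
  define Q :: "'a \<times> 'a \<times> 'a \<times> 'a \<Rightarrow> 'a \<times> 'a \<times> 'a \<times> 'a \<Rightarrow> bool" where "Q p q \<longleftrightarrow> (\<exists>!k. k < 4 \<and> coord k p = coord k q)" for p q
  have arcs: "parcs ?H = U \<times> V \<union> V \<times> U \<longleftrightarrow>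
      (\<forall>p\<in>W. \<forall>q\<in>W. Q p q \<longleftrightarrow> (p, q) \<in> U \<times> V \<union> V \<times> U)"
    if "W = U \<union> V" "W \<subseteq> quadruples R C A B" for U V
    using that(1) subsetD[OF that(2)] by (intro eq_bipartite_relation_iff)
      (auto simp only: parcs_ols_graph_iff Q_def pair_pre_digraph.simps mem_Collect_eq fst_conv snd_conv)
  have fin: "finite U" if "card U = 4" for U :: "'b set"
    using that by (simp add: card_ge_0_finite)
  show ?thesis
    unfolding K44_pattern_def H complete_bipartite_digraph_pair_def Q_def[symmetric]
  proof (intro iffI conjI; elim conjE exE)
    fix U V
    assume W: "W \<subseteq> quadruples R C A B"
    {
      assume "pverts ?H = U \<union> V" "U \<inter> V = {}" "card U = 4" "card V = 4" "parcs ?H = U \<times> V \<union> V \<times> U"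
      then show "\<exists>U V. W = U \<union> V \<and> U \<inter> V = {} \<and> card U = 4 \<and> card V = 4 \<and>
          (\<forall>p\<in>W. \<forall>q\<in>W. Q p q \<longleftrightarrow> (p, q) \<in> U \<times> V \<union> V \<times> U)"
        using arcs[of U V] W by - (rule exI[of _ U], rule exI[of _ V], simp)
    next
      assume UV: "W = U \<union> V" "U \<inter> V = {}" "card U = 4" "card V = 4"
        "\<forall>p\<in>W. \<forall>q\<in>W. Q p q \<longleftrightarrow> (p, q) \<in> U \<times> V \<union> V \<times> U"
      then show "card W = 8" "finite (pverts ?H)"
        by (simp_all add: card_Un_disjoint fin)
      show "\<exists>U V. pverts ?H = U \<union> V \<and> U \<inter> V = {} \<and> card U = 4 \<and> card V = 4 \<and>
          parcs ?H = U \<times> V \<union> V \<times> U"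
        using arcs[of U V] W UV by - (rule exI[of _ U], rule exI[of _ V], simp)
    }
  qed
qed

text \<open>Distinctness in every coordinate makes each side independent, so only the 16 cross pairs
  remain to be checked.\<close>

lemma K44_patternI:
  assumes quads: "set ps \<union> set qs \<subseteq> quadruples R C A B"
    and len: "length ps = 4" "length qs = 4"
    and ps: "\<And>k. k < 4 \<Longrightarrow> distinct (map (coord k) ps)"
    and qs: "\<And>k. k < 4 \<Longrightarrow> distinct (map (coord k) qs)"
    and pq: "\<And>p q. p \<in> set ps \<Longrightarrow> q \<in> set qs \<Longrightarrow> \<exists>!k. k < 4 \<and> coord k p = coord k q"
  shows "K44_pattern R C A B (set ps \<union> set qs)"
proof -
  \<comment> \<open>A quadruple agrees with itself in four positions, not one. This excludes loops
    and also makes the two sides disjoint.\<close>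
  have same: "\<not> (\<exists>!k. k < 4 \<and> coord k x = coord k x)" for x :: "'a \<times> 'a \<times> 'a \<times> 'a"
    unfolding ex1_less_4 by simp
  have indep: "\<not> (\<exists>!k. k < 4 \<and> coord k x = coord k y)"
    if that': "\<And>k. k < 4 \<Longrightarrow> distinct (map (coord k) xs)" and "x \<in> set xs" "y \<in> set xs" for xs x y
  proof (cases "x = y")
    case False
    have "coord k x \<noteq> coord k y" if "k < 4" for k
      using that False \<open>x \<in> set xs\<close> \<open>y \<in> set xs\<close> that'[OF that]
      by (auto simp: distinct_map inj_on_def)
    then show ?thesis by blast
  qed (use same in simp)
  have card: "card (set ps) = 4" "card (set qs) = 4"
    using ps[of 0] qs[of 0] len by (auto simp: distinct_map distinct_card)
  have disj: "set ps \<inter> set qs = {}"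
    using pq same by blast
  have qp: "\<exists>!k. k < 4 \<and> coord k q = coord k p" if "p \<in> set ps" "q \<in> set qs" for p q
    using pq[OF that] by (simp add: eq_commute)
  show ?thesis
    unfolding K44_pattern_iff
  proof (rule conjI[OF quads], rule exI[of _ "set ps"], rule exI[of _ "set qs"], intro conjI ballI)
    fix p q
    assume "p \<in> set ps \<union> set qs" "q \<in> set ps \<union> set qs"
    then consider "p \<in> set ps" "q \<in> set ps" | "p \<in> set ps" "q \<in> set qs"
      | "p \<in> set qs" "q \<in> set ps" | "p \<in> set qs" "q \<in> set qs"
      by blast
    then show "(\<exists>!k. k < 4 \<and> coord k p = coord k q) \<longleftrightarrow>
        (p, q) \<in> set ps \<times> set qs \<union> set qs \<times> set ps"
    proof cases
      case 1
      then show ?thesis using indep[OF ps] disj by blast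
    next
      case 2
      then show ?thesis using pq by blast
    next
      case 3
      then show ?thesis using qp by blast
    next
      case 4
      then show ?thesis using indep[OF qs] disj by blast
    qed
  qed (use quads card disj in simp_all)
qed

text \<open>Numbering both lists from 0, \<open>ps ! i\<close> and \<open>qs ! j\<close> share the
  coordinate \<open>a\<close>, \<open>r\<close>, \<open>b\<close> or \<open>c\<close> according as
  \<open>j - i\<close> is 0, 1, 2 or 3 modulo 4.\<close>

lemma cyclic_K44_pattern:
  fixes r0 c0 a0 b0 :: 'a
  assumes "distinct [r0, r1, r2, r3]" "distinct [c0, c1, c2, c3]"
    "distinct [a0, a1, a2, a3]" "distinct [b0, b1, b2, b3]"
  defines "ps \<equiv> [(r0, c0, a0, b0), (r1, c1, a1, b1), (r2, c2, a2, b2), (r3, c3, a3, b3)]"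
    and "qs \<equiv> [(r3, c1, a0, b2), (r0, c2, a1, b3), (r1, c3, a2, b0), (r2, c0, a3, b1)]"
  assumes "set ps \<union> set qs \<subseteq> quadruples R C A B"
  shows "K44_pattern R C A B (set ps \<union> set qs)"
proof (rule K44_patternI)
  have "\<forall>k<4. distinct (map (coord k) ps)" "\<forall>k<4. distinct (map (coord k) qs)"
    using assms(1-4) by (auto simp: all_less_4 ps_def qs_def)
  then show "distinct (map (coord k) ps)" "distinct (map (coord k) qs)" if "k < 4" for k
    using that by auto
  have "\<forall>p\<in>set ps. \<forall>q\<in>set qs. \<exists>!k. k < 4 \<and> coord k p = coord k q"
    \<comment> \<open>The reversed lists supply every inequality in the opposite
      orientation.\<close>
    using assms(1-4) assms(1-4)[THEN distinct_rev[THEN iffD2]]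
    unfolding ex1_less_4 ps_def qs_def by simp
  then show "\<exists>!k. k < 4 \<and> coord k p = coord k q" if "p \<in> set ps" "q \<in> set qs" for p q
    using that by blast
  show "set ps \<union> set qs \<subseteq> quadruples R C A B"
    by fact
qed (simp_all add: ps_def qs_def)

text \<open>Here the shared coordinate is number \<open>i\<close> XOR \<open>j\<close> in the order
  \<open>r\<close>, \<open>c\<close>, \<open>a\<close>, \<open>b\<close>.\<close>

lemma klein_K44_pattern:
  fixes r0 c0 a0 b0 :: 'a
  assumes "distinct [r0, r1, r2, r3]" "distinct [c0, c1, c2, c3]"
    "distinct [a0, a1, a2, a3]" "distinct [b0, b1, b2, b3]"
  defines "ps \<equiv> [(r0, c0, a0, b0), (r1, c1, a1, b1), (r2, c2, a2, b2), (r3, c3, a3, b3)]"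
    and "qs \<equiv> [(r0, c1, a2, b3), (r1, c0, a3, b2), (r2, c3, a0, b1), (r3, c2, a1, b0)]"
  assumes "set ps \<union> set qs \<subseteq> quadruples R C A B"
  shows "K44_pattern R C A B (set ps \<union> set qs)"
proof (rule K44_patternI)
  have "\<forall>k<4. distinct (map (coord k) ps)" "\<forall>k<4. distinct (map (coord k) qs)"
    using assms(1-4) by (auto simp: all_less_4 ps_def qs_def)
  then show "distinct (map (coord k) ps)" "distinct (map (coord k) qs)" if "k < 4" for k
    using that by auto
  have "\<forall>p\<in>set ps. \<forall>q\<in>set qs. \<exists>!k. k < 4 \<and> coord k p = coord k q"
    using assms(1-4) assms(1-4)[THEN distinct_rev[THEN iffD2]]
    unfolding ex1_less_4 ps_def qs_def by simp
  then show "\<exists>!k. k < 4 \<and> coord k p = coord k q" if "p \<in> set ps" "q \<in> set qs" for p q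
    using that by blast
  show "set ps \<union> set qs \<subseteq> quadruples R C A B"
    by fact
qed (simp_all add: ps_def qs_def)

text \<open>Any two positions determine a quadruple: by the latin property if exactly one of them is
  a row or column, by orthogonality for the two table values. Hence distinct quadruples agreeing
  somewhere are adjacent.\<close>

lemma ols_coord_unique:
  assumes A: "latin_square n S S S (table_triples S S A)"
    and B: "latin_square n S S S (table_triples S S B)"
    and orth: "orthogonal S S A B"
    and p: "p \<in> quadruples S S A B" and q: "q \<in> quadruples S S A B"
    and j: "j < 4" "coord j p = coord j q" and k: "k < 4" "coord k p = coord k q" and "j \<noteq> k"
  shows "p = q"
proof -
  obtain r c r' c' where p_eq: "p = (r, c, A r c, B r c)" and q_eq: "q = (r', c', A r' c', B r' c')"
    and S: "r \<in> S" "c \<in> S" "r' \<in> S" "c' \<in> S"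
    using p q by (auto simp: quadruples_def)
  have latin: "r = r' \<and> c = c'"
    if "latin_square n S S S (table_triples S S T)" "T r c = T r' c'" "r = r' \<or> c = c'" for T
  proof -
    have "of_bool (r \<noteq> r') + of_bool (c \<noteq> c') + of_bool (T r c \<noteq> T r' c') \<noteq> (1::nat)"
      using that(1) S unfolding latin_square_def table_triples_def by blast
    then show ?thesis
      using that(2,3) by (cases "r = r'"; cases "c = c'") auto
  qed
  define eR eC eA eB where
    eqs: "eR \<longleftrightarrow> r = r'" "eC \<longleftrightarrow> c = c'" "eA \<longleftrightarrow> A r c = A r' c'" "eB \<longleftrightarrow> B r c = B r' c'"
  have agree: "i = 0 \<and> eR \<or> i = 1 \<and> eC \<or> i = 2 \<and> eA \<or> i = 3 \<and> eB"
    if "i < 4" "coord i p = coord i q" for i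
  proof -
    have "i = 0 \<or> i = 1 \<or> i = 2 \<or> i = 3"
      using that(1) by arith
    then show ?thesis
      using that(2) unfolding eqs by (auto simp: p_eq q_eq)
  qed
  have "eA \<and> (eR \<or> eC) \<longrightarrow> eR \<and> eC" "eB \<and> (eR \<or> eC) \<longrightarrow> eR \<and> eC" "eA \<and> eB \<longrightarrow> eR \<and> eC"
    using latin[OF A] latin[OF B] orth S unfolding eqs orthogonal_def by blast+
  then have "eR \<and> eC"
    using agree[OF j] agree[OF k] \<open>j \<noteq> k\<close> by auto
  then have "r = r' \<and> c = c'"
    by (simp add: eqs)
  then show ?thesis
    by (simp add: p_eq q_eq)
qed

section \<open>Linear pairs without patterns\<close>

text \<open>In the next two lemmas \<open>x\<^sub>i\<close> and \<open>y\<^sub>i\<close> are two coordinates of the vertices \<open>p\<^sub>i\<close> of one side of a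
  pattern, in terms of which the other two are \<open>a x + b y\<close> and \<open>c x + d y\<close>. Each equation is one edge;
  the vertices of the other side have been eliminated, since each shares its \<open>x\<close> with one \<open>p\<^sub>i\<close> and
  its \<open>y\<close> with another.\<close>

lemma (in field) cyclic_pattern_relation:
  assumes [simp]: "a \<in> carrier R" "b \<in> carrier R" "c \<in> carrier R" "d \<in> carrier R"
    and [simp]: "x0 \<in> carrier R" "x1 \<in> carrier R" "x2 \<in> carrier R"
      "y0 \<in> carrier R" "y1 \<in> carrier R" "y2 \<in> carrier R" "y3 \<in> carrier R"
    and b: "b \<noteq> \<zero>" and nz: "b \<otimes> c \<noteq> (\<one> \<oplus> \<one>) \<otimes> a \<otimes> d"
    and E1: "a \<otimes> x0 \<oplus> b \<otimes> y0 = a \<otimes> x2 \<oplus> b \<otimes> y3"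
    and E2: "a \<otimes> x2 \<oplus> b \<otimes> y2 = a \<otimes> x0 \<oplus> b \<otimes> y1"
    and E3: "c \<otimes> x0 \<oplus> d \<otimes> y0 = c \<otimes> x1 \<oplus> d \<otimes> y2"
    and E4: "c \<otimes> x1 \<oplus> d \<otimes> y1 = c \<otimes> x2 \<oplus> d \<otimes> y3"
  shows "x0 = x2"
proof -
  note carr = assms(1-11)
  \<comment> \<open>The differences of the two sides are named so that each deduction becomes a
    polynomial identity.\<close>
  define e1 where "e1 = (a \<otimes> x0 \<oplus> b \<otimes> y0) \<ominus> (a \<otimes> x2 \<oplus> b \<otimes> y3)"
  define e2 where "e2 = (a \<otimes> x2 \<oplus> b \<otimes> y2) \<ominus> (a \<otimes> x0 \<oplus> b \<otimes> y1)"
  define e3 where "e3 = (c \<otimes> x0 \<oplus> d \<otimes> y0) \<ominus> (c \<otimes> x1 \<oplus> d \<otimes> y2)"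
  define e4 where "e4 = (c \<otimes> x1 \<oplus> d \<otimes> y1) \<ominus> (c \<otimes> x2 \<oplus> d \<otimes> y3)"
  have e: "e1 = \<zero>" "e2 = \<zero>" "e3 = \<zero>" "e4 = \<zero>"
    unfolding e1_def e2_def e3_def e4_def E1 E2 E3 E4 by (simp_all add: r_right_minus_eq)
  \<comment> \<open>In the sum of \<open>E1\<close> and \<open>E2\<close> the \<open>x\<close> terms
    cancel, so \<open>b s = 0\<close>.\<close>
  define s where "s = (y0 \<oplus> y2) \<ominus> (y1 \<oplus> y3)"
  have s: "s \<in> carrier R"
    by (simp add: s_def)
  have "b \<otimes> s = e1 \<oplus> e2"
    unfolding s_def e1_def e2_def using carr by algebra
  then have "s = \<zero>"
    using integral[of b s] b s e by simp
  \<comment> \<open>\<open>E1\<close> says \<open>a u = b w\<close>, and \<open>E3\<close> plus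
    \<open>E4\<close> with \<open>s = 0\<close> says \<open>c u = 2 d w\<close>. Eliminating
    \<open>w\<close> gives \<open>b c u = 2 a d u\<close>, whence \<open>u = 0\<close> by
    \<open>nz\<close>.\<close>
  define u w where "u = x0 \<ominus> x2" and "w = y3 \<ominus> y0"
  have uw [simp]: "u \<in> carrier R" "w \<in> carrier R"
    by (simp_all add: u_def w_def)
  have "a \<otimes> u = b \<otimes> w \<oplus> e1"
    unfolding u_def w_def e1_def using carr by algebra
  then have au: "a \<otimes> u = b \<otimes> w"
    by (simp add: e)
  have "c \<otimes> u = (d \<otimes> w \<oplus> d \<otimes> w) \<oplus> (e3 \<oplus> e4 \<oplus> d \<otimes> s)"
    unfolding u_def w_def e3_def e4_def s_def using carr by algebra
  then have cu: "c \<otimes> u = d \<otimes> w \<oplus> d \<otimes> w"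
    by (simp add: e \<open>s = \<zero>\<close>)
  have "b \<otimes> c \<otimes> u = b \<otimes> (c \<otimes> u)"
    by (simp add: m_assoc)
  also have "\<dots> = (\<one> \<oplus> \<one>) \<otimes> d \<otimes> (b \<otimes> w)"
    unfolding cu using carr uw by algebra
  also have "\<dots> = (\<one> \<oplus> \<one>) \<otimes> a \<otimes> d \<otimes> u"
    unfolding au[symmetric] using carr uw by algebra
  finally have "u = \<zero>"
    using m_rcancel[of u "b \<otimes> c" "(\<one> \<oplus> \<one>) \<otimes> a \<otimes> d"] nz by auto
  then have "x0 \<ominus> x2 = \<zero>"
    by (simp add: u_def)
  then show ?thesis
    by (simp add: r_right_minus_eq)
qed

lemma (in field) klein_pattern_relation:
  assumes [simp]: "a \<in> carrier R" "b \<in> carrier R" "c \<in> carrier R" "d \<in> carrier R"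
    and [simp]: "x0 \<in> carrier R" "x2 \<in> carrier R" "x3 \<in> carrier R"
      "y0 \<in> carrier R" "y1 \<in> carrier R" "y2 \<in> carrier R" "y3 \<in> carrier R"
    and b: "b \<noteq> \<zero>" and d: "d \<noteq> \<zero>" and two: "\<one> \<oplus> \<one> \<noteq> \<zero>"
    and E1: "a \<otimes> x0 \<oplus> b \<otimes> y0 = a \<otimes> x2 \<oplus> b \<otimes> y3"
    and E2: "a \<otimes> x2 \<oplus> b \<otimes> y2 = a \<otimes> x0 \<oplus> b \<otimes> y1"
    and E3: "c \<otimes> x0 \<oplus> d \<otimes> y0 = c \<otimes> x3 \<oplus> d \<otimes> y2"
    and E4: "c \<otimes> x3 \<oplus> d \<otimes> y3 = c \<otimes> x0 \<oplus> d \<otimes> y1"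
  shows "y0 = y1"
proof -
  note carr = assms(1-11)
  define e1 where "e1 = (a \<otimes> x0 \<oplus> b \<otimes> y0) \<ominus> (a \<otimes> x2 \<oplus> b \<otimes> y3)"
  define e2 where "e2 = (a \<otimes> x2 \<oplus> b \<otimes> y2) \<ominus> (a \<otimes> x0 \<oplus> b \<otimes> y1)"
  define e3 where "e3 = (c \<otimes> x0 \<oplus> d \<otimes> y0) \<ominus> (c \<otimes> x3 \<oplus> d \<otimes> y2)"
  define e4 where "e4 = (c \<otimes> x3 \<oplus> d \<otimes> y3) \<ominus> (c \<otimes> x0 \<oplus> d \<otimes> y1)"
  have e: "e1 = \<zero>" "e2 = \<zero>" "e3 = \<zero>" "e4 = \<zero>"
    unfolding e1_def e2_def e3_def e4_def E1 E2 E3 E4 by (simp_all add: r_right_minus_eq)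
  \<comment> \<open>\<open>E1\<close> and \<open>E2\<close> give \<open>s = 0\<close>,
    \<open>E3\<close> and \<open>E4\<close> give \<open>t = 0\<close>, and \<open>s + t\<close> is
    \<open>2 (y0 - y1)\<close>.\<close>
  define s t where "s = (y0 \<oplus> y2) \<ominus> (y1 \<oplus> y3)" and "t = (y0 \<oplus> y3) \<ominus> (y1 \<oplus> y2)"
  have st: "s \<in> carrier R" "t \<in> carrier R"
    by (simp_all add: s_def t_def)
  have "b \<otimes> s = e1 \<oplus> e2"
    unfolding s_def e1_def e2_def using carr by algebra
  then have "s = \<zero>"
    using integral[of b s] b st e by simp
  have "d \<otimes> t = e3 \<oplus> e4"
    unfolding t_def e3_def e4_def using carr by algebra
  then have "t = \<zero>"
    using integral[of d t] d st e by simp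
  have "(\<one> \<oplus> \<one>) \<otimes> (y0 \<ominus> y1) = s \<oplus> t"
    unfolding s_def t_def using carr by algebra
  then have "y0 \<ominus> y1 = \<zero>"
    using integral[of "\<one> \<oplus> \<one>" "y0 \<ominus> y1"] two by (simp add: \<open>s = \<zero>\<close> \<open>t = \<zero>\<close>)
  then show ?thesis
    by (simp add: r_right_minus_eq)
qed

section \<open>The pairs \<open>r + c\<close> and \<open>r + l c\<close>\<close>

abbreviation sum_table :: "('a, 'z) ring_scheme \<Rightarrow> 'a \<Rightarrow> 'a \<Rightarrow> 'a \<Rightarrow> 'a" where
  "sum_table F l \<equiv> (\<lambda>r c. r \<oplus>\<^bsub>F\<^esub> l \<otimes>\<^bsub>F\<^esub> c)"

lemma (in field) linear_ols_pair_sum_tables: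
  assumes fin: "finite (carrier R)" and l: "l \<in> carrier R" "l \<noteq> \<zero>" "l \<noteq> \<one>"
  shows "linear_ols_pair (order R) R (sum_table R \<one>) (sum_table R l)"
proof -
  have latin: "latin_square (order R) (carrier R) (carrier R) (carrier R)
      (table_triples (carrier R) (carrier R) (sum_table R k))"
    if k: "k \<in> carrier R" "k \<noteq> \<zero>" for k
  proof (rule latin_square_table_triples)
    show "inj_on (\<lambda>c. r \<oplus> k \<otimes> c) (carrier R)" if "r \<in> carrier R" for r
      using that k by (auto intro!: inj_onI simp: m_lcancel)
    show "inj_on (\<lambda>r. r \<oplus> k \<otimes> c) (carrier R)" if "c \<in> carrier R" for c
      using that k by (auto intro!: inj_onI)
  qed (use fin k in \<open>auto simp: order_def\<close>)
  have "orthogonal (carrier R) (carrier R) (sum_table R \<one>) (sum_table R l)"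
    unfolding orthogonal_def
  proof (intro ballI impI)
    fix r c r' c'
    assume rc: "r \<in> carrier R" "c \<in> carrier R" "r' \<in> carrier R" "c' \<in> carrier R"
      and eq: "r \<oplus> \<one> \<otimes> c = r' \<oplus> \<one> \<otimes> c' \<and> r \<oplus> l \<otimes> c = r' \<oplus> l \<otimes> c'"
    \<comment> \<open>Subtracting the two equations eliminates the rows;
      \<open>l \<noteq> \<one>\<close> then forces equal columns.\<close>
    have "(l \<ominus> \<one>) \<otimes> (c \<ominus> c') = ((r \<oplus> l \<otimes> c) \<ominus> (r' \<oplus> l \<otimes> c')) \<ominus> ((r \<oplus> \<one> \<otimes> c) \<ominus> (r' \<oplus> \<one> \<otimes> c'))"
      using rc l by algebra
    also have "\<dots> = \<zero>"
      using eq rc l by (simp add: a_minus_def r_neg)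
    finally have "c = c'"
      using integral[of "l \<ominus> \<one>" "c \<ominus> c'"] rc l by (simp add: r_right_minus_eq)
    then show "(r, c) = (r', c')"
      using eq rc by simp
  qed
  moreover have "linear_fun2 R (sum_table R k)" if "k \<in> carrier R" for k
  proof -
    have "(r \<oplus> r') \<oplus> k \<otimes> (c \<oplus> c') = (r \<oplus> k \<otimes> c) \<oplus> (r' \<oplus> k \<otimes> c')"
      "r \<otimes> c \<oplus> k \<otimes> (r \<otimes> c') = r \<otimes> (c \<oplus> k \<otimes> c')"
      if "r \<in> carrier R" "c \<in> carrier R" "r' \<in> carrier R" "c' \<in> carrier R" for r c r' c'
      using that \<open>k \<in> carrier R\<close> by algebra+
    then show ?thesis
      using that by (auto simp: linear_fun2_def)
  qed
  ultimately show ?thesis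
    using fin l field_axioms by (auto simp: linear_ols_pair_def is_GF_def intro!: latin)
qed

text \<open>The forms are \<open>r + t c\<close> with \<open>t\<close> equal to 0, infinity, 1 and
  \<open>l\<close>. The values -1, 2 and 1/2 of \<open>l\<close> are the harmonic cross ratios, and
  avoiding each of them refutes one of the three cyclic orders.\<close>

lemma (in field) K44_free_sum_tables:
  assumes fin: "finite (carrier R)" and l: "l \<in> carrier R" "l \<noteq> \<zero>" "l \<noteq> \<one>"
    and two: "\<one> \<oplus> \<one> \<noteq> \<zero>"
    and cross_ratio: "\<one> \<oplus> l \<noteq> \<zero>" "l \<noteq> \<one> \<oplus> \<one>" "(\<one> \<oplus> \<one>) \<otimes> l \<noteq> \<one>"
  shows "K44_free (carrier R) (carrier R) (sum_table R \<one>) (sum_table R l)"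
  unfolding K44_free_def
proof
  let ?Q = "quadruples (carrier R) (carrier R) (sum_table R \<one>) (sum_table R l)"
  assume "\<exists>W. K44_pattern (carrier R) (carrier R) (sum_table R \<one>) (sum_table R l) W"
  then obtain W where W: "K44_pattern (carrier R) (carrier R) (sum_table R \<one>) (sum_table R l) W" ..
  have sub: "W \<subseteq> ?Q"
    using W unfolding K44_pattern_iff by (rule conjunct1)
  from W obtain U V where UVW: "W = U \<union> V" and UV': "U \<inter> V = {}" "card U = 4" "card V = 4"
    and adj': "\<forall>p\<in>W. \<forall>q\<in>W. (\<exists>!k. k < 4 \<and> coord k p = coord k q) \<longleftrightarrow> (p, q) \<in> U \<times> V \<union> V \<times> U"
    unfolding K44_pattern_iff by (elim conjE exE) (rule that)
  note UV = sub[unfolded UVW] UV' and adj = adj'[unfolded UVW, rule_format]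
  have ols: "linear_ols_pair (order R) R (sum_table R \<one>) (sum_table R l)"
    by (rule linear_ols_pair_sum_tables[OF fin l])
  have unique: "p = q"
    if "p \<in> ?Q" "q \<in> ?Q" "j < 4" "coord j p = coord j q" "k < 4" "coord k p = coord k q" "j \<noteq> k" for p q j k
    by (rule ols_coord_unique[OF _ _ _ that]) (use ols in \<open>auto simp: linear_ols_pair_def\<close>)
  \<comment> \<open>Distinct vertices that agree in some position are adjacent by
    \<open>unique\<close>, which cannot happen within one side.\<close>
  have indep: "p = q"
    if "p \<in> Z" "q \<in> Z" "k < 4" "coord k p = coord k q" "Z = U \<or> Z = V" for p q k Z
  proof (rule ccontr)
    assume "p \<noteq> q"
    moreover have "p \<in> U \<union> V" "q \<in> U \<union> V"
      using that by auto
    ultimately have "\<exists>!k. k < 4 \<and> coord k p = coord k q"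
      using unique[of p q] UV(1) that(3,4) by blast
    then show False
      using adj[of p q] that UV(2) by blast
  qed
  \<comment> \<open>Two neighbours of a vertex that share the same position with it agree there with
    each other, so rows and columns of \<open>L\<close> have no repeated symbol.\<close>
  define L where "L p q = (THE k. k < 4 \<and> coord k p = coord k q)" for p q :: "'a \<times> 'a \<times> 'a \<times> 'a"
  have L: "L p q < 4" "coord (L p q) p = coord (L p q) q" if "p \<in> U" "q \<in> V" for p q
    using theI'[of "\<lambda>k. k < 4 \<and> coord k p = coord k q"] adj[of p q] that
    unfolding L_def by auto
  have inj_row: "inj_on (L p) V" if "p \<in> U" for p
  proof (rule inj_onI)
    fix q q' assume q: "q \<in> V" "q' \<in> V" "L p q = L p q'"
    have "coord (L p q) q = coord (L p q) q'"
      using L(2)[OF that q(1)] L(2)[OF that q(2)] q(3) by simp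
    then show "q = q'"
      using indep[OF q(1,2) L(1)[OF that q(1)]] by simp
  qed
  have inj_col: "inj_on (\<lambda>p. L p q) U" if "q \<in> V" for q
  proof (rule inj_onI)
    fix p p' assume p: "p \<in> U" "p' \<in> U" "L p q = L p' q"
    have "coord (L p q) p = coord (L p q) p'"
      using L(2)[OF p(1) that] L(2)[OF p(2) that] p(3) by simp
    then show "p = p'"
      using indep[OF p(1,2) L(1)[OF p(1) that]] by simp
  qed
  obtain p q where p: "p ` {..<4} \<subseteq> U" "inj_on p {..<4}" and q: "q ` {..<4} \<subseteq> V"
    and normal_form: "(\<forall>i<4. \<forall>j<4. L (p i) (q j) = [[0,1,2,3],[1,0,3,2],[2,3,0,1],[3,2,1,0]] ! i ! j) \<or>
      (\<exists>f\<in>{[0,1,2,3],[0,2,1,3],[0,1,3,2]}. \<forall>i<4. \<forall>j<4. L (p i) (q j) = f ! ((i + j) mod 4))"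
    by (rule latin_square_4_normal_form[OF UV(3,4) L(1) inj_row inj_col])
  have pU: "p i \<in> U" "p i \<in> ?Q" and qV: "q i \<in> V" "q i \<in> ?Q" if "i < 4" for i
    using that p q UV(1) by auto
  have edge: "coord (L (p i) (q j)) (p i) = coord (L (p i) (q j)) (q j)" if "i < 4" "j < 4" for i j
    using L(2) pU qV that by blast
  have distinct: "coord k (p i) \<noteq> coord k (p j)" if "i < 4" "j < 4" "i \<noteq> j" "k < 4" for i j k
    using indep[of "p i" U "p j" k] that pU inj_onD[OF p(2), of i j] by auto
  have quad: "coord 0 s \<in> carrier R" "coord 1 s \<in> carrier R"
    "coord 2 s = coord 0 s \<oplus> coord 1 s" "coord 3 s = coord 0 s \<oplus> l \<otimes> coord 1 s" if "s \<in> ?Q" for s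
    using that l by (auto simp: quadruples_def)
  \<comment> \<open>All three cyclic orders are treated at once: the first two coordinates in the
    order \<open>f\<close> act as \<open>x\<close> and \<open>y\<close>, and \<open>rel\<close>
    expresses the other two through them.\<close>
  have cyclic: False
    if f: "f \<in> {[0,1,2,3],[0,2,1,3],[0,1,3,2]}"
      and table: "\<forall>i<4. \<forall>j<4. L (p i) (q j) = f ! ((i + j) mod 4)"
      and abcd: "a \<in> carrier R" "b \<in> carrier R" "c \<in> carrier R" "d \<in> carrier R"
      and nz: "b \<noteq> \<zero>" "b \<otimes> c \<noteq> (\<one> \<oplus> \<one>) \<otimes> a \<otimes> d"
      and rel: "\<And>s. s \<in> ?Q \<Longrightarrow> coord (f ! 2) s = a \<otimes> coord (f ! 0) s \<oplus> b \<otimes> coord (f ! 1) s"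
        "\<And>s. s \<in> ?Q \<Longrightarrow> coord (f ! 3) s = c \<otimes> coord (f ! 0) s \<oplus> d \<otimes> coord (f ! 1) s"
    for f a b c d
  proof -
    have edge': "coord (f ! ((i + j) mod 4)) (p i) = coord (f ! ((i + j) mod 4)) (q j)"
      if "i < 4" "j < 4" for i j
      using edge[OF that] table that by simp
    have carr: "coord (f ! 0) s \<in> carrier R" "coord (f ! 1) s \<in> carrier R" if "s \<in> ?Q" for s
      using f quad[OF that] l by auto
    \<comment> \<open>These six edges express \<open>x\<close> and \<open>y\<close> of
      \<open>q 0\<close>, \<open>q 2\<close> and \<open>q 3\<close> through the vertices
      \<open>p i\<close>; the four edges in \<open>e2\<close> and \<open>e3\<close> then become the
      equations of \<open>cyclic_pattern_relation\<close>.\<close>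
    note x = edge'[of 0 0, simplified] edge'[of 1 3, simplified] edge'[of 2 2, simplified]
    note y = edge'[of 1 0, simplified] edge'[of 2 3, simplified] edge'[of 3 2, simplified]
    have e2: "coord (f ! 2) (p 0) = coord (f ! 2) (q 2)" "coord (f ! 2) (p 2) = coord (f ! 2) (q 0)"
      using edge'[of 0 2] edge'[of 2 0] by (simp_all add: numeral_2_eq_2)
    note e3 = edge'[of 0 3, simplified] edge'[of 1 2, simplified]
    have "coord (f ! 0) (p 0) = coord (f ! 0) (p 2)"
    proof (rule cyclic_pattern_relation[OF abcd _ _ _ _ _ _ _ nz])
      show "a \<otimes> coord (f ! 0) (p 0) \<oplus> b \<otimes> coord (f ! 1) (p 0) =
          a \<otimes> coord (f ! 0) (p 2) \<oplus> b \<otimes> coord (f ! 1) (p 3)"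
        using e2(1) rel(1)[of "p 0"] rel(1)[of "q 2"] pU(2) qV(2) x y by simp
      show "a \<otimes> coord (f ! 0) (p 2) \<oplus> b \<otimes> coord (f ! 1) (p 2) =
          a \<otimes> coord (f ! 0) (p 0) \<oplus> b \<otimes> coord (f ! 1) (p 1)"
        using e2(2) rel(1)[of "p 2"] rel(1)[of "q 0"] pU(2) qV(2) x y by simp
      show "c \<otimes> coord (f ! 0) (p 0) \<oplus> d \<otimes> coord (f ! 1) (p 0) =
          c \<otimes> coord (f ! 0) (p 1) \<oplus> d \<otimes> coord (f ! 1) (p 2)"
        using e3(1) rel(2)[of "p 0"] rel(2)[of "q 3"] pU(2) qV(2) x y by simp
      show "c \<otimes> coord (f ! 0) (p 1) \<oplus> d \<otimes> coord (f ! 1) (p 1) =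
          c \<otimes> coord (f ! 0) (p 2) \<oplus> d \<otimes> coord (f ! 1) (p 3)"
        using e3(2) rel(2)[of "p 1"] rel(2)[of "q 2"] pU(2) qV(2) x y by simp
    qed (use carr pU in simp_all)
    then show False
      using distinct[of 0 2 "f ! 0"] f by auto
  qed
  from normal_form show False
  proof (elim disjE bexE)
    assume table: "\<forall>i<4. \<forall>j<4. L (p i) (q j) = [[0,1,2,3],[1,0,3,2],[2,3,0,1],[3,2,1,0]] ! i ! j"
    have x: "coord 0 (q 0) = coord 0 (p 0)" "coord 0 (q 2) = coord 0 (p 2)" "coord 0 (q 3) = coord 0 (p 3)"
      and y: "coord 1 (q 0) = coord 1 (p 1)" "coord 1 (q 2) = coord 1 (p 3)" "coord 1 (q 3) = coord 1 (p 2)"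
      and e: "coord 2 (p 0) = coord 2 (q 2)" "coord 2 (p 2) = coord 2 (q 0)"
        "coord 3 (p 0) = coord 3 (q 3)" "coord 3 (p 3) = coord 3 (q 0)"
      using edge[of 0 0] edge[of 2 2] edge[of 3 3] edge[of 1 0] edge[of 3 2] edge[of 2 3]
        edge[of 0 2] edge[of 2 0] edge[of 0 3] edge[of 3 0] table by simp_all
    have "coord 1 (p 0) = coord 1 (p 1)"
    proof (rule klein_pattern_relation)
      show "\<one> \<otimes> coord 0 (p 0) \<oplus> \<one> \<otimes> coord 1 (p 0) = \<one> \<otimes> coord 0 (p 2) \<oplus> \<one> \<otimes> coord 1 (p 3)"
        "\<one> \<otimes> coord 0 (p 2) \<oplus> \<one> \<otimes> coord 1 (p 2) = \<one> \<otimes> coord 0 (p 0) \<oplus> \<one> \<otimes> coord 1 (p 1)"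
        "\<one> \<otimes> coord 0 (p 0) \<oplus> l \<otimes> coord 1 (p 0) = \<one> \<otimes> coord 0 (p 3) \<oplus> l \<otimes> coord 1 (p 2)"
        "\<one> \<otimes> coord 0 (p 3) \<oplus> l \<otimes> coord 1 (p 3) = \<one> \<otimes> coord 0 (p 0) \<oplus> l \<otimes> coord 1 (p 1)"
        using e pU(2) qV(2) by (simp_all add: quad x y del: One_nat_def)
    qed (use pU quad l two in \<open>simp_all del: One_nat_def\<close>)
    then show False
      using distinct[of 0 1 1] by simp
  next
    fix f
    assume f: "f \<in> {[0,1,2,3],[0,2,1,3],[0,1,3,2]}"
      and table: "\<forall>i<4. \<forall>j<4. L (p i) (q j) = f ! ((i + j) mod 4)"
    from f consider "f = [0,1,2,3]" | "f = [0,2,1,3]" | "f = [0,1,3,2]" by auto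
    then show False
    proof cases
      case 1
      \<comment> \<open>Here \<open>nz\<close> reads \<open>1 \<noteq> 2 l\<close>.\<close>
      show False
        by (rule cyclic[OF f table, of \<one> \<one> \<one> l])
          (use l cross_ratio(3)[symmetric] quad in \<open>simp_all add: 1\<close>)
    next
      case 2
      \<comment> \<open>Now the basic coordinates are \<open>r\<close> and \<open>r + c\<close>, so
        \<open>c\<close> and \<open>r + l c\<close> are rewritten in them. The two sides of
        \<open>nz\<close> differ by \<open>1 + l\<close>.\<close>
      have y_rel: "y = \<ominus> \<one> \<otimes> x \<oplus> \<one> \<otimes> (x \<oplus> y)" and
        b_rel: "x \<oplus> l \<otimes> y = (\<one> \<ominus> l) \<otimes> x \<oplus> l \<otimes> (x \<oplus> y)"
        if "x \<in> carrier R" "y \<in> carrier R" for x y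
        using that l by algebra+
      have "\<one> \<otimes> (\<one> \<ominus> l) \<noteq> (\<one> \<oplus> \<one>) \<otimes> (\<ominus> \<one>) \<otimes> l"
      proof
        assume *: "\<one> \<otimes> (\<one> \<ominus> l) = (\<one> \<oplus> \<one>) \<otimes> (\<ominus> \<one>) \<otimes> l"
        have "\<one> \<oplus> l = \<one> \<otimes> (\<one> \<ominus> l) \<ominus> (\<one> \<oplus> \<one>) \<otimes> (\<ominus> \<one>) \<otimes> l"
          using l by algebra
        then show False
          using cross_ratio(1) l by (simp add: * r_right_minus_eq)
      qed
      note nz = this
      show False
      proof (rule cyclic[OF f table _ _ _ _ _ nz])
        fix s
        assume s: "s \<in> ?Q"
        have f_nth: "f ! 0 = 0" "f ! 1 = 2" "f ! 2 = 1" "f ! 3 = 3"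
          by (simp_all add: 2)
        show "coord (f ! 2) s = \<ominus> \<one> \<otimes> coord (f ! 0) s \<oplus> \<one> \<otimes> coord (f ! 1) s"
          unfolding f_nth quad(3)[OF s] by (rule y_rel[OF quad(1,2)[OF s]])
        show "coord (f ! 3) s = (\<one> \<ominus> l) \<otimes> coord (f ! 0) s \<oplus> l \<otimes> coord (f ! 1) s"
          unfolding f_nth quad(3,4)[OF s] by (rule b_rel[OF quad(1,2)[OF s]])
      qed (use l in simp_all)
    next
      case 3
      \<comment> \<open>Here \<open>nz\<close> reads \<open>l \<noteq> 2\<close>.\<close>
      show False
        by (rule cyclic[OF f table, of \<one> l \<one> \<one>])
          (use l cross_ratio(2) quad in \<open>simp_all add: 3\<close>)
    qed
  qed
qed

section \<open>Linear pairs with patterns\<close>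

lemma (in field) order_add_pow_one:
  assumes "finite (carrier R)"
  shows "[order R] \<cdot> \<one> = \<zero>"
  using add.pow_order_eq_1[of \<one>] assms by (simp add: order_def)

lemma (in field) two_neq_zero_if_odd_order:
  assumes fin: "finite (carrier R)" and odd: "odd (order R)"
  shows "\<one> \<oplus> \<one> \<noteq> \<zero>"
proof
  assume two: "\<one> \<oplus> \<one> = \<zero>"
  have "[(2 * k)] \<cdot> \<one> = \<zero>" for k :: nat
    by (induction k) (simp_all add: a_assoc two)
  moreover obtain k where "order R = Suc (2 * k)"
    using odd by (auto elim!: oddE)
  ultimately show False
    using order_add_pow_one[OF fin] by simp
qed

lemma (in field) exists_K44_pattern_char_not_2:
  assumes fin: "finite (carrier R)" and order: "order R \<ge> 4" and two: "\<one> \<oplus> \<one> \<noteq> \<zero>"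
  shows "\<exists>W. K44_pattern (carrier R) (carrier R) (sum_table R \<one>) (sum_table R (\<ominus> \<one>)) W"
proof -
  have "card {\<zero>, \<one>, \<ominus> \<one>} < card (carrier R)"
    using order card_insert_le_m1[of 3 "{\<one>, \<ominus> \<one>}" \<zero>] card_insert_le_m1[of 2 "{\<ominus> \<one>}" \<one>]
    by (simp add: order_def)
  then obtain v where v: "v \<in> carrier R" "v \<noteq> \<zero>" "v \<noteq> \<one>" "v \<noteq> \<ominus> \<one>"
    using fin card_mono[of "{\<zero>, \<one>, \<ominus> \<one>}" "carrier R"] by force
  have double: "x = \<zero>" if "x \<in> carrier R" "x \<oplus> x = \<zero>" for x
  proof -
    have "(\<one> \<oplus> \<one>) \<otimes> x = \<zero>"
      using that by (simp add: l_distr)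
    then show ?thesis
      using integral[of "\<one> \<oplus> \<one>" x] that two by auto
  qed
  have neg: "x \<noteq> \<ominus> x" if "x \<in> carrier R" "x \<noteq> \<zero>" for x
    using that double[of x] r_neg[of x] by metis
  have four: "distinct [x, y, \<ominus> x, \<ominus> y]"
    if "x \<in> carrier R" "y \<in> carrier R" "x \<noteq> \<zero>" "y \<noteq> \<zero>" "x \<noteq> y" "x \<noteq> \<ominus> y" for x y
  proof -
    have "\<ominus> x \<noteq> \<ominus> y" "\<ominus> x \<noteq> y"
      using that minus_minus by metis+
    then show ?thesis
      using that neg[of x] neg[of y] by auto
  qed
  \<comment> \<open>These are the table values at \<open>(v, 1)\<close>. They vanish only for
    \<open>v = -1\<close> and \<open>v = 1\<close> respectively; \<open>s = t\<close> would mean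
    \<open>2 = 0\<close>, and \<open>s = -t\<close> would mean \<open>2 v = 0\<close>.\<close>
  define s t where "s = v \<oplus> \<one>" and "t = v \<ominus> \<one>"
  have st: "s \<in> carrier R" "t \<in> carrier R" "s \<noteq> \<zero>" "t \<noteq> \<zero>" "s \<noteq> t" "s \<noteq> \<ominus> t"
  proof -
    show "s \<in> carrier R" "t \<in> carrier R"
      using v by (simp_all add: s_def t_def)
    show "s \<noteq> \<zero>"
      using minus_equality[of v \<one>] v by (auto simp: s_def)
    show "t \<noteq> \<zero>"
      using v by (simp add: t_def r_right_minus_eq)
    show "s \<noteq> t"
      using v neg[of \<one>] add.l_cancel[of v \<one> "\<ominus> \<one>"] by (auto simp: s_def t_def a_minus_def)
    have "\<ominus> t = \<one> \<oplus> \<ominus> v"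
      unfolding t_def using v(1) by algebra
    then show "s \<noteq> \<ominus> t"
      using v neg[of v] add.l_cancel[of \<one> v "\<ominus> v"] by (auto simp: s_def a_comm)
  qed
  note vs = four[OF v(1) one_closed v(2) one_not_zero v(3,4)] and ss = four[OF st]
  \<comment> \<open>The points of \<open>?ps\<close> arise from \<open>(v, 1)\<close> by repeating
    \<open>(x, y) \<mapsto> (-y, x)\<close>; \<open>?qs\<close> exchanges row and column in each.
    Every coordinate runs through \<open>v, 1, -v, -1\<close> or \<open>s, t, -s, -t\<close>, so
    \<open>four\<close> gives all distinctness.\<close>
  let ?ps = "[(v, \<one>, s, t), (\<ominus> \<one>, v, t, \<ominus> s), (\<ominus> v, \<ominus> \<one>, \<ominus> s, \<ominus> t), (\<one>, \<ominus> v, \<ominus> t, s)]"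
  let ?qs = "[(\<one>, v, s, \<ominus> t), (v, \<ominus> \<one>, t, s), (\<ominus> \<one>, \<ominus> v, \<ominus> s, t), (\<ominus> v, \<one>, \<ominus> t, \<ominus> s)]"
  have "K44_pattern (carrier R) (carrier R) (sum_table R \<one>) (sum_table R (\<ominus> \<one>)) (set ?ps \<union> set ?qs)"
  proof (rule cyclic_K44_pattern)
    have q: "(x, y, a, b) \<in> quadruples (carrier R) (carrier R) (sum_table R \<one>) (sum_table R (\<ominus> \<one>))"
      if "x \<in> carrier R" "y \<in> carrier R" "a = x \<oplus> \<one> \<otimes> y" "b = x \<oplus> \<ominus> \<one> \<otimes> y" for x y a b
      using that by (auto simp: quadruples_def)
    have "s = v \<oplus> \<one> \<otimes> \<one>" "t = v \<oplus> \<ominus> \<one> \<otimes> \<one>"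
      "t = \<ominus> \<one> \<oplus> \<one> \<otimes> v" "\<ominus> s = \<ominus> \<one> \<oplus> \<ominus> \<one> \<otimes> v"
      "\<ominus> s = \<ominus> v \<oplus> \<one> \<otimes> \<ominus> \<one>" "\<ominus> t = \<ominus> v \<oplus> \<ominus> \<one> \<otimes> \<ominus> \<one>"
      "\<ominus> t = \<one> \<oplus> \<one> \<otimes> \<ominus> v" "s = \<one> \<oplus> \<ominus> \<one> \<otimes> \<ominus> v"
      "s = \<one> \<oplus> \<one> \<otimes> v" "\<ominus> t = \<one> \<oplus> \<ominus> \<one> \<otimes> v"
      "t = v \<oplus> \<one> \<otimes> \<ominus> \<one>" "s = v \<oplus> \<ominus> \<one> \<otimes> \<ominus> \<one>"
      "\<ominus> s = \<ominus> \<one> \<oplus> \<one> \<otimes> \<ominus> v" "t = \<ominus> \<one> \<oplus> \<ominus> \<one> \<otimes> \<ominus> v"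
      "\<ominus> t = \<ominus> v \<oplus> \<one> \<otimes> \<one>" "\<ominus> s = \<ominus> v \<oplus> \<ominus> \<one> \<otimes> \<one>"
      unfolding s_def t_def using v(1) by algebra+
    note * = this
    show "set ?ps \<union> set ?qs \<subseteq> quadruples (carrier R) (carrier R) (sum_table R \<one>) (sum_table R (\<ominus> \<one>))"
      unfolding list.set Un_insert_left Un_empty_left insert_subset
      by (intro conjI empty_subsetI q one_closed v(1) a_inv_closed *)
  qed (use vs ss in auto)
  then show ?thesis ..
qed

text \<open>The translation by \<open>(0, 1)\<close> works because its four coordinates are the row
  of the first point of the group, the column of the second, the sum of the third and the last value
  of the fourth. Translating any group element therefore produces the Klein table.\<close>

lemma (in field) exists_K44_pattern_char_2:
  assumes two: "\<one> \<oplus> \<one> = \<zero>" and b: "b \<in> carrier R" "b \<noteq> \<zero>" "b \<noteq> \<one>"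
  shows "\<exists>W. K44_pattern (carrier R) (carrier R) (sum_table R \<one>) (sum_table R (\<one> \<oplus> b)) W"
proof -
  have dbl: "x \<oplus> x = \<zero>" if "x \<in> carrier R" for x
    using that two l_distr[of \<one> \<one> x] by simp
  have dbl': "x \<oplus> (x \<oplus> y) = y" if "x \<in> carrier R" "y \<in> carrier R" for x y
    using that dbl[of x] by (simp add: a_assoc[symmetric])
  have eq_iff: "x = y" if "x \<oplus> y = \<zero>" "x \<in> carrier R" "y \<in> carrier R" for x y
    using that dbl'[of x y] by simp
  define c d where "c = \<one> \<oplus> b" and "d = b \<otimes> b"
  have cd: "c \<in> carrier R" "d \<in> carrier R" "c \<noteq> \<zero>" "c \<noteq> \<one>" "c \<noteq> b" "d \<noteq> \<zero>" "d \<noteq> \<one>" "d \<noteq> b"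
  proof -
    show carr: "c \<in> carrier R" "d \<in> carrier R"
      using b by (simp_all add: c_def d_def)
    show "c \<noteq> \<zero>"
      using eq_iff[of \<one> b] b by (auto simp: c_def)
    then have "c \<otimes> c \<noteq> \<zero>"
      using integral[of c c] carr by auto
    moreover have "c \<otimes> c = \<one> \<oplus> d"
      using b by (simp add: c_def d_def a_ac l_distr r_distr dbl')
    ultimately show "d \<noteq> \<one>"
      using two by auto
    show "c \<noteq> \<one>" "c \<noteq> b"
      using b by (simp_all add: c_def)
    show "d \<noteq> \<zero>"
      using integral[of b b] b by (auto simp: d_def)
    show "d \<noteq> b"
      using m_lcancel[of b b \<one>] b by (auto simp: d_def)
  qed
  have cancel: "x \<oplus> y = x \<oplus> z \<longleftrightarrow> y = z" "y \<oplus> x = x \<oplus> z \<longleftrightarrow> y = z" "x \<oplus> y = z \<oplus> x \<longleftrightarrow> y = z"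
    "y \<oplus> x = z \<oplus> x \<longleftrightarrow> y = z"
    if "x \<in> carrier R" "y \<in> carrier R" "z \<in> carrier R" for x y z
    using that by (simp_all add: a_comm[of x])
  have neq: "\<one> \<oplus> d \<noteq> \<zero>" "b \<oplus> d \<noteq> \<zero>" "\<one> \<oplus> d \<noteq> c" "\<one> \<oplus> d \<noteq> b \<oplus> d" "b \<oplus> d \<noteq> c" "\<one> \<oplus> d \<noteq> d"
    "\<one> \<oplus> d \<noteq> \<one>"
    using eq_iff[of \<one> d] eq_iff[of b d] b cd by (auto simp: c_def cancel)
  \<comment> \<open>The fourth point of \<open>?ps\<close> is the sum of the second and third;
    \<open>?qs\<close> adds \<open>\<one>\<close> to each column. The table values are simplified
    using \<open>1 + 1 = 0\<close>.\<close>
  let ?ps = "[(\<zero>, \<zero>, \<zero>, \<zero>), (\<one> \<oplus> d, \<one>, d, b \<oplus> d), (c, b, \<one>, \<one> \<oplus> d), (b \<oplus> d, c, \<one> \<oplus> d, c)]"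
  let ?qs = "[(\<zero>, \<one>, \<one>, c), (\<one> \<oplus> d, \<zero>, \<one> \<oplus> d, \<one> \<oplus> d), (c, c, \<zero>, b \<oplus> d), (b \<oplus> d, b, d, \<zero>)]"
  have "K44_pattern (carrier R) (carrier R) (sum_table R \<one>) (sum_table R (\<one> \<oplus> b)) (set ?ps \<union> set ?qs)"
  proof (rule klein_K44_pattern)
    have q: "(x, y, a, e) \<in> quadruples (carrier R) (carrier R) (sum_table R \<one>) (sum_table R (\<one> \<oplus> b))"
      if "x \<in> carrier R" "y \<in> carrier R" "a = x \<oplus> \<one> \<otimes> y" "e = x \<oplus> (\<one> \<oplus> b) \<otimes> y" for x y a e
      using that by (auto simp: quadruples_def)
    show "set ?ps \<union> set ?qs \<subseteq> quadruples (carrier R) (carrier R) (sum_table R \<one>) (sum_table R (\<one> \<oplus> b))"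
      unfolding list.set Un_insert_left Un_empty_left insert_subset
      by (intro conjI empty_subsetI q)
        (use b in \<open>simp_all add: c_def d_def a_ac l_distr r_distr dbl dbl'\<close>)
    show "distinct [\<zero>, \<one> \<oplus> d, c, b \<oplus> d]" "distinct [\<zero>, \<one>, b, c]"
      "distinct [\<zero>, d, \<one>, \<one> \<oplus> d]" "distinct [\<zero>, b \<oplus> d, \<one> \<oplus> d, c]"
      using b cd neq neq[symmetric] by auto
  qed
  then show ?thesis ..
qed

section \<open>Choice of the field and of the second table\<close>

theorem corollary1:
  shows "(\<forall>q::nat. primepow q \<and> odd q \<and> q \<ge> 7 \<longrightarrow>
            (\<exists>(F :: nat ring) A B. linear_ols_pair q F A B \<and>
               K44_free (carrier F) (carrier F) A B)) \<and>
         (\<forall>q::nat. primepow q \<and> q \<ge> 4 \<longrightarrow>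
            (\<exists>(F :: nat ring) A B. linear_ols_pair q F A B \<and>
               (\<exists>W. K44_pattern (carrier F) (carrier F) A B W)))"
proof (intro conjI allI impI; elim conjE)
  fix q :: nat
  assume q: "primepow q" "odd q" "q \<ge> 7"
  obtain F :: "nat ring" where F: "field F" "finite (carrier F)" "order F = q"
    using exists_GF[OF q(1)] by auto
  interpret field F by fact
  have two: "\<one>\<^bsub>F\<^esub> \<oplus>\<^bsub>F\<^esub> \<one>\<^bsub>F\<^esub> \<noteq> \<zero>\<^bsub>F\<^esub>"
    using F q two_neq_zero_if_odd_order by simp
  let ?two = "\<one>\<^bsub>F\<^esub> \<oplus>\<^bsub>F\<^esub> \<one>\<^bsub>F\<^esub>"
  \<comment> \<open>The values 0 and 1 would destroy the orthogonal pair, the other three are the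
    harmonic cross ratios. Five values cannot exhaust a field with at least 7 elements.\<close>
  let ?bad = "{\<zero>\<^bsub>F\<^esub>, \<one>\<^bsub>F\<^esub>, \<ominus>\<^bsub>F\<^esub> \<one>\<^bsub>F\<^esub>, ?two, inv\<^bsub>F\<^esub> ?two}"
  have "card ?bad \<le> 5"
    using card_length[of "[\<zero>\<^bsub>F\<^esub>, \<one>\<^bsub>F\<^esub>, \<ominus>\<^bsub>F\<^esub> \<one>\<^bsub>F\<^esub>, ?two, inv\<^bsub>F\<^esub> ?two]"] by simp
  then have "\<not> carrier F \<subseteq> ?bad"
    using F q(3) card_mono[of ?bad "carrier F"] by (auto simp: order_def)
  then obtain l where l: "l \<in> carrier F" "l \<notin> ?bad"
    by blast
  have "?two \<otimes>\<^bsub>F\<^esub> l \<noteq> \<one>\<^bsub>F\<^esub>"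
    using comm_inv_char[of ?two l] l by auto
  moreover have "\<one>\<^bsub>F\<^esub> \<oplus>\<^bsub>F\<^esub> l \<noteq> \<zero>\<^bsub>F\<^esub>"
    using minus_equality[of l "\<one>\<^bsub>F\<^esub>"] l by (auto simp: a_comm)
  ultimately have "K44_free (carrier F) (carrier F) (sum_table F \<one>\<^bsub>F\<^esub>) (sum_table F l)"
    using l two F by (intro K44_free_sum_tables) auto
  moreover have "linear_ols_pair q F (sum_table F \<one>\<^bsub>F\<^esub>) (sum_table F l)"
    using linear_ols_pair_sum_tables[of l] l F by auto
  ultimately show "\<exists>(F :: nat ring) A B. linear_ols_pair q F A B \<and> K44_free (carrier F) (carrier F) A B"
    by blast
next
  fix q :: nat
  assume q: "primepow q" "q \<ge> 4"
  obtain F :: "nat ring" where F: "field F" "finite (carrier F)" "order F = q"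
    using exists_GF[OF q(1)] by auto
  interpret field F by fact
  let ?two = "\<one>\<^bsub>F\<^esub> \<oplus>\<^bsub>F\<^esub> \<one>\<^bsub>F\<^esub>"
  \<comment> \<open>In characteristic 2 the witness is \<open>1 + b\<close> with \<open>b\<close>
    outside \<open>{0, 1}\<close>, otherwise it is \<open>-1\<close>.\<close>
  have "\<exists>l\<in>carrier F. l \<noteq> \<zero>\<^bsub>F\<^esub> \<and> l \<noteq> \<one>\<^bsub>F\<^esub> \<and>
      (\<exists>W. K44_pattern (carrier F) (carrier F) (sum_table F \<one>\<^bsub>F\<^esub>) (sum_table F l) W)"
  proof (cases "?two = \<zero>\<^bsub>F\<^esub>")
    case True
    have "card {\<zero>\<^bsub>F\<^esub>, \<one>\<^bsub>F\<^esub>} \<le> 2"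
      using card_length[of "[\<zero>\<^bsub>F\<^esub>, \<one>\<^bsub>F\<^esub>]"] by simp
    then have "\<not> carrier F \<subseteq> {\<zero>\<^bsub>F\<^esub>, \<one>\<^bsub>F\<^esub>}"
      using F q(2) card_mono[of "{\<zero>\<^bsub>F\<^esub>, \<one>\<^bsub>F\<^esub>}" "carrier F"] by (auto simp: order_def)
    then obtain b where b: "b \<in> carrier F" "b \<noteq> \<zero>\<^bsub>F\<^esub>" "b \<noteq> \<one>\<^bsub>F\<^esub>"
      by blast
    have "\<one>\<^bsub>F\<^esub> \<oplus>\<^bsub>F\<^esub> b \<noteq> \<zero>\<^bsub>F\<^esub>"
    proof
      assume "\<one>\<^bsub>F\<^esub> \<oplus>\<^bsub>F\<^esub> b = \<zero>\<^bsub>F\<^esub>"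
      then have "\<one>\<^bsub>F\<^esub> \<oplus>\<^bsub>F\<^esub> b = \<one>\<^bsub>F\<^esub> \<oplus>\<^bsub>F\<^esub> \<one>\<^bsub>F\<^esub>"
        by (simp add: True)
      then show False
        using b add.l_cancel[of "\<one>\<^bsub>F\<^esub>" b "\<one>\<^bsub>F\<^esub>"] by simp
    qed
    moreover have "\<one>\<^bsub>F\<^esub> \<oplus>\<^bsub>F\<^esub> b \<noteq> \<one>\<^bsub>F\<^esub>"
      using b by simp
    ultimately show ?thesis
      using exists_K44_pattern_char_2[OF True b] b by blast
  next
    case False
    have "\<ominus>\<^bsub>F\<^esub> \<one>\<^bsub>F\<^esub> \<noteq> \<one>\<^bsub>F\<^esub>"
      using False l_neg[of "\<one>\<^bsub>F\<^esub>"] by auto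
    moreover have "\<ominus>\<^bsub>F\<^esub> \<one>\<^bsub>F\<^esub> \<noteq> \<zero>\<^bsub>F\<^esub>"
      using l_neg[of "\<one>\<^bsub>F\<^esub>"] by auto
    ultimately show ?thesis
      using exists_K44_pattern_char_not_2[OF F(2) _ False] F(3) q(2)
      by (intro bexI[of _ "\<ominus>\<^bsub>F\<^esub> \<one>\<^bsub>F\<^esub>"] conjI) simp_all
  qed
  then show "\<exists>(F :: nat ring) A B. linear_ols_pair q F A B \<and>
      (\<exists>W. K44_pattern (carrier F) (carrier F) A B W)"
    using linear_ols_pair_sum_tables F by blast
qed

end
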